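(* Let $G,H$ be finitely generated groups with $G$ a finite index subgroup of $H$. Then $H$ has a logspace normal form if and only if $G$ has a logspace normal form.
   Context: A deterministic logspace transducer is a deterministic machine with a finite state control and three tapes: a read-only input tape storing the input word; a read-write work tape restricted to at most $c\log n$ squares, where $n$ is the length of the input word and $c$ is a fixed constant; and a write-only output tape written from left to right. In each transition it may modify the work tape, change state, move the input read-head, and write at most a fixed constant number of letters to the output tape. For finite alphabets $X,Y$, a function $f:X^*\to Y^*$ is logspace computable if some deterministic logspace transducer outputs $f(w)$ on every input $w\in X^*$ ($X^*$ is the set of finite words over $X$, including the empty word $\lambda$). Let $G$ be a group with finite symmetric (closed under inverses) generating set $X$; for $w\in X^*$ let $\overline{w}\in G$ denote the element it represents. A normal form for $(G,X)$ is a subset $L\subseteq X^*$ such that $w\mapsto\overline{w}$ restricts to a bijection $L\to G$. A logspace normal form function for $(G,X)$ is a logspace computable $f:X^*\to X^*$ such that, for some normal form $L$, $f(w)$ is the unique element of $L$ with $\overline{f(w)}=\overline{w}$, for all $w\in X^*$. $(G,X)$ has a logspace normal form if it has a logspace normal form function; $G$ has a logspace normal form if $(G,X)$ does for some finite symmetric generating set $X$. *)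

theory Defs
  imports Complex_Main "HOL-Algebra.Coset" "HOL-Algebra.Generated_Groups"
begin

section \<open>Deterministic logspace transducers\<close>

(* The input word w occupies the input squares 1, ..., length w; square 0 and square
   length w + 1 carry end markers, so that the machine can recognise the ends of its input. *)
datatype 'x input_symbol = Left_End | Letter 'x | Right_End

datatype head_move = Go_Left | Stay | Go_Right

(* States and work-tape symbols are coded by natural numbers; the well-formedness condition
   below restricts both to finite sets.  delta q a s is the transition in state q with a under
   the input head and s under the work head: (new state, symbol written on the work tape,
   move of the work head, move of the input head, word appended to the output). *)
record ('x, 'y) transducer =
  states :: "nat set"
  start :: nat
  final :: "nat set"
  work_symbols :: "nat set"
  blank :: nat
  delta :: "nat \<Rightarrow> 'x input_symbol \<Rightarrow> nat \<Rightarrow> nat \<times> nat \<times> head_move \<times> head_move \<times> 'y list"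

definition input_symbols :: "'x set \<Rightarrow> 'x input_symbol set" where
  "input_symbols X = {Left_End, Right_End} \<union> Letter ` X"

(* As delta has only finitely many relevant arguments, the number of letters
   written in a single transition is bounded by a constant. *)
definition wf_transducer :: "'x set \<Rightarrow> 'y set \<Rightarrow> ('x, 'y) transducer \<Rightarrow> bool" where
  "wf_transducer X Y M \<longleftrightarrow>
     finite X \<and> finite Y \<and> finite (states M) \<and> finite (work_symbols M) \<and>
     start M \<in> states M \<and> final M \<subseteq> states M \<and> blank M \<in> work_symbols M \<and>
     (\<forall>q \<in> states M. \<forall>a \<in> input_symbols X. \<forall>s \<in> work_symbols M.
        case delta M q a s of (q', s', mw, mi, out) \<Rightarrow>
          q' \<in> states M \<and> s' \<in> work_symbols M \<and> out \<in> lists Y)"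

(* The work tape is infinite to the right, with squares 0, 1, 2, ... *)
record 'y configuration =
  state :: nat
  input_pos :: nat
  work_tape :: "nat \<Rightarrow> nat"
  work_pos :: nat
  written :: "'y list"

definition scan :: "'x list \<Rightarrow> nat \<Rightarrow> 'x input_symbol" where
  "scan w i = (if i = 0 then Left_End
               else if i \<le> length w then Letter (w ! (i - 1)) else Right_End)"

(* A head on square 0 that is told to move left stays where it is. *)
fun move_head :: "head_move \<Rightarrow> nat \<Rightarrow> nat" where
  "move_head Go_Left i = i - 1"
| "move_head Stay i = i"
| "move_head Go_Right i = i + 1"

definition initial_config :: "('x, 'y) transducer \<Rightarrow> 'y configuration" where
  "initial_config M =
     \<lparr>state = start M, input_pos = 0, work_tape = (\<lambda>_. blank M), work_pos = 0, written = []\<rparr>"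

definition step :: "('x, 'y) transducer \<Rightarrow> 'x list \<Rightarrow> 'y configuration \<Rightarrow> 'y configuration" where
  "step M w C =
     (if state C \<in> final M then C
      else case delta M (state C) (scan w (input_pos C)) (work_tape C (work_pos C)) of
        (q', s', mw, mi, out) \<Rightarrow>
          \<lparr>state = q',
           input_pos = min (length w + 1) (move_head mi (input_pos C)),
           work_tape = (work_tape C)(work_pos C := s'),
           work_pos = move_head mw (work_pos C),
           written = written C @ out\<rparr>)"

definition config_at :: "('x, 'y) transducer \<Rightarrow> 'x list \<Rightarrow> nat \<Rightarrow> 'y configuration" where
  "config_at M w t = (step M w ^^ t) (initial_config M)"

definition outputs :: "('x, 'y) transducer \<Rightarrow> 'x list \<Rightarrow> 'y list \<Rightarrow> bool" where
  "outputs M w v \<longleftrightarrow>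
     (\<exists>t. state (config_at M w t) \<in> final M \<and> written (config_at M w t) = v)"

(* A computation whose work head never leaves squares 0, ..., p uses at most p + 1 squares.
   The argument of the logarithm is shifted by 2 so that the bound also makes sense for
   inputs of length 0 and 1; for n \<ge> 2 this only changes the constant c. *)
definition logspace_bounded :: "'x set \<Rightarrow> ('x, 'y) transducer \<Rightarrow> bool" where
  "logspace_bounded X M \<longleftrightarrow>
     (\<exists>c::real. \<forall>w \<in> lists X. \<forall>t.
        real (work_pos (config_at M w t) + 1) \<le> c * log 2 (real (length w + 2)))"

definition logspace_computable :: "'x set \<Rightarrow> 'y set \<Rightarrow> ('x list \<Rightarrow> 'y list) \<Rightarrow> bool" where
  "logspace_computable X Y f \<longleftrightarrow>
     (\<exists>M. wf_transducer X Y M \<and> logspace_bounded X M \<and> (\<forall>w \<in> lists X. outputs M w (f w)))"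


section \<open>Logspace normal forms\<close>

definition finitely_generated :: "('a, 'b) monoid_scheme \<Rightarrow> bool" where
  "finitely_generated G \<longleftrightarrow>
     (\<exists>S. finite S \<and> S \<subseteq> carrier G \<and> generate G S = carrier G)"

definition finite_symmetric_generating_set :: "('a, 'b) monoid_scheme \<Rightarrow> 'a set \<Rightarrow> bool" where
  "finite_symmetric_generating_set G X \<longleftrightarrow>
     finite X \<and> X \<subseteq> carrier G \<and> (\<forall>x \<in> X. inv\<^bsub>G\<^esub> x \<in> X) \<and> generate G X = carrier G"

definition word_value :: "('a, 'b) monoid_scheme \<Rightarrow> 'a list \<Rightarrow> 'a" where
  "word_value G w = foldr (\<otimes>\<^bsub>G\<^esub>) w \<one>\<^bsub>G\<^esub>"

definition normal_form :: "('a, 'b) monoid_scheme \<Rightarrow> 'a set \<Rightarrow> 'a list set \<Rightarrow> bool" where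
  "normal_form G X L \<longleftrightarrow> L \<subseteq> lists X \<and> bij_betw (word_value G) L (carrier G)"

definition logspace_normal_form_function ::
    "('a, 'b) monoid_scheme \<Rightarrow> 'a set \<Rightarrow> ('a list \<Rightarrow> 'a list) \<Rightarrow> bool" where
  "logspace_normal_form_function G X f \<longleftrightarrow>
     logspace_computable X X f \<and>
     (\<exists>L. normal_form G X L \<and>
          (\<forall>w \<in> lists X. f w \<in> L \<and> word_value G (f w) = word_value G w))"

definition has_logspace_normal_form_wrt :: "('a, 'b) monoid_scheme \<Rightarrow> 'a set \<Rightarrow> bool" where
  "has_logspace_normal_form_wrt G X \<longleftrightarrow> (\<exists>f. logspace_normal_form_function G X f)"

definition has_logspace_normal_form :: "('a, 'b) monoid_scheme \<Rightarrow> bool" where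
  "has_logspace_normal_form G \<longleftrightarrow>
     (\<exists>X. finite_symmetric_generating_set G X \<and> has_logspace_normal_form_wrt G X)"

end

theory Submission
  imports Defs "HOL-Library.Countable_Set"
begin

text \<open>
  Choose a representative \<open>rep c\<close> in every right coset \<open>c\<close> of the subgroup \<open>G\<close>, with
  \<open>rep G = 1\<close>. While a word \<open>x\<^sub>1 \<dots> x\<^sub>n\<close> over generators of \<open>H\<close> is read, keep track of the cosets
  \<open>c\<^sub>i = G x\<^sub>1 \<dots> x\<^sub>i\<close> and replace the letter \<open>x\<^sub>i\<close> by the Schreier element
  \<open>rep c\<^sub>i\<^sub>-\<^sub>1 x\<^sub>i (rep c\<^sub>i)\<^sup>-\<^sup>1\<close>, which lies in \<open>G\<close>. The product telescopes, so the word has the value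
  of the rewritten word times \<open>rep c\<^sub>n\<close> (lemma \<open>schreier_rewriting\<close>).

  Given a normal form function \<open>f\<close> for \<open>G\<close>, write the Schreier elements as words over the
  generators of \<open>G\<close>, apply \<open>f\<close> to the rewritten word and append the letter \<open>rep c\<^sub>n\<close>; this is a
  normal form function for \<open>H\<close>. Given a normal form function \<open>f\<close> for \<open>H\<close>, the Schreier elements
  generate \<open>G\<close>; spell a word over them as a word over the generators of \<open>H\<close>, apply \<open>f\<close>, and rewrite
  the result. In both cases the outcome depends only on the group element, as \<open>f\<close> does.

  It remains to see that these compositions are logspace computable. All the maps around \<open>f\<close> are
  sequential: they translate letter by letter with a finite control. Translating the output of a
  machine for \<open>f\<close> is easy, since the output can be translated while it is being written
  (\<open>logspace_computable_translate_output\<close>). Translating its input is less obvious, because the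
  machine moves both ways on the translated word, which is too long to be stored. Here it helps that
  the translations are reversible: each generator permutes the cosets of \<open>G\<close>. So a machine whose
  head walks on the original word can update the coset in both directions, and a position on
  the translated word is a position on the original word together with a bounded amount of
  information, which fits into the finite control. The simulation then runs step by step with the
  same work tape (\<open>logspace_computable_translate_input\<close>). It needs that no letter is translated to
  the empty word, so that every head move is simulated by a single step; any group element can be
  spelled by a nonempty word as soon as there is a generator, and this can be arranged
  (\<open>has_logspace_normal_formE\<close>).
\<close>

section \<open>Sequential translations\<close>

text \<open>The output of a sequential transducer with transitions d and outputs u, started in state s;
  the state it ends in is \<open>foldl d s w\<close>.\<close>
primrec translate ::
    "('s \<Rightarrow> 'x \<Rightarrow> 's) \<Rightarrow> ('s \<Rightarrow> 'x \<Rightarrow> 'y list) \<Rightarrow> 's \<Rightarrow> 'x list \<Rightarrow> 'y list" where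
  "translate d u s [] = []"
| "translate d u s (x # w) = u s x @ translate d u (d s x) w"

lemma translate_append:
  "translate d u s (v @ w) = translate d u s v @ translate d u (foldl d s v) w"
  by (induction v arbitrary: s) auto

lemma foldl_closed:
  assumes "\<And>s x. s \<in> Q \<Longrightarrow> x \<in> X \<Longrightarrow> d s x \<in> Q" "s \<in> Q" "w \<in> lists X"
  shows "foldl d s w \<in> Q"
  using assms(3,2) by (induction w arbitrary: s) (auto simp: assms(1))

lemma translate_in_lists:
  assumes "\<And>s x. s \<in> Q \<Longrightarrow> x \<in> X \<Longrightarrow> d s x \<in> Q" "\<And>s x. s \<in> Q \<Longrightarrow> x \<in> X \<Longrightarrow> u s x \<in> lists Y"
    and "s \<in> Q" "w \<in> lists X"
  shows "translate d u s w \<in> lists Y"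
  using assms(4,3) by (induction w arbitrary: s) (auto simp: assms(1) assms(2)[simplified])

lemma length_translate_le:
  assumes "\<And>s x. s \<in> Q \<Longrightarrow> x \<in> X \<Longrightarrow> d s x \<in> Q" "\<And>s x. s \<in> Q \<Longrightarrow> x \<in> X \<Longrightarrow> length (u s x) \<le> K"
    and "s \<in> Q" "w \<in> lists X"
  shows "length (translate d u s w) \<le> K * length w"
  using assms(4,3)
proof (induction w arbitrary: s)
  case (Cons x w)
  have "length (u s x) \<le> K" "length (translate d u (d s x) w) \<le> K * length w"
    using Cons assms(1,2) by auto
  then show ?case by simp
qed auto


section \<open>Computations of transducers\<close>

lemma config_at_0: "config_at M w 0 = initial_config M"
  by (simp add: config_at_def)

lemma config_at_Suc: "config_at M w (Suc t) = step M w (config_at M w t)"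
  by (simp add: config_at_def)

lemma step_final: "state C \<in> final M \<Longrightarrow> step M w C = C"
  by (simp add: step_def)

lemma scan_in_input_symbols: "w \<in> lists X \<Longrightarrow> scan w i \<in> input_symbols X"
  by (auto simp: scan_def input_symbols_def in_lists_conv_set)

lemma wf_transducer_delta:
  assumes "wf_transducer X Y M" "q \<in> states M" "a \<in> input_symbols X" "b \<in> work_symbols M"
    and "delta M q a b = (q', b', mw, mi, v)"
  shows "q' \<in> states M" "b' \<in> work_symbols M" "v \<in> lists Y"
proof -
  have "\<forall>q \<in> states M. \<forall>a \<in> input_symbols X. \<forall>b \<in> work_symbols M.
      case delta M q a b of (q', b', mw, mi, v) \<Rightarrow>
        q' \<in> states M \<and> b' \<in> work_symbols M \<and> v \<in> lists Y"
    using assms(1) by (simp add: wf_transducer_def)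
  note bspec[OF bspec[OF bspec[OF this assms(2)] assms(3)] assms(4)]
  then show "q' \<in> states M" "b' \<in> work_symbols M" "v \<in> lists Y"
    by (simp_all add: assms(5))
qed

lemma config_at_wf:
  assumes "wf_transducer X Y M" "w \<in> lists X"
  shows "state (config_at M w t) \<in> states M" "work_tape (config_at M w t) k \<in> work_symbols M"
    "written (config_at M w t) \<in> lists Y"
proof -
  have "state (config_at M w t) \<in> states M \<and> (\<forall>k. work_tape (config_at M w t) k \<in> work_symbols M) \<and>
    written (config_at M w t) \<in> lists Y"
  proof (induction t)
    case 0
    then show ?case using assms by (auto simp: config_at_0 initial_config_def wf_transducer_def)
  next
    case (Suc t)
    define C where "C = config_at M w t"
    obtain q' s' mw mi out where
      d: "delta M (state C) (scan w (input_pos C)) (work_tape C (work_pos C)) = (q', s', mw, mi, out)"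
      by (metis prod_cases5)
    have "q' \<in> states M" "s' \<in> work_symbols M" "out \<in> lists Y"
      using wf_transducer_delta[OF assms(1) _ scan_in_input_symbols[OF assms(2)] _ d] Suc
      by (simp_all add: C_def)
    then show ?case
      using Suc unfolding config_at_Suc C_def[symmetric] by (auto simp: step_def d)
  qed
  then show "state (config_at M w t) \<in> states M" "work_tape (config_at M w t) k \<in> work_symbols M"
    "written (config_at M w t) \<in> lists Y"
    by auto
qed

lemma logspace_computable_Nil:
  assumes "finite X" "finite Y"
  shows "logspace_computable X Y (\<lambda>_. [])"
proof -
  define M :: "('a, 'b) transducer" where "M = \<lparr>states = {0}, start = 0, final = {0},
    work_symbols = {0}, blank = 0, delta = (\<lambda>_ _ _. (0, 0, Stay, Stay, []))\<rparr>"
  have c: "config_at M w t = initial_config M" for w t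
    by (induction t) (auto simp: config_at_0 config_at_Suc step_def initial_config_def M_def)
  have "wf_transducer X Y M"
    using assms by (auto simp: wf_transducer_def M_def)
  moreover have "logspace_bounded X M"
    unfolding logspace_bounded_def c
    by (rule exI[of _ 1]) (auto simp: initial_config_def)
  moreover have "outputs M w []" for w
    unfolding outputs_def c by (simp add: initial_config_def M_def)
  ultimately show ?thesis
    unfolding logspace_computable_def by blast
qed


section \<open>Translating the output\<close>

text \<open>The machine for the composition runs the given machine and keeps the state of the sequential
  transducer next to the state of the machine; what the machine writes is translated at
  once. States are pairs, which are numbered because a machine has natural numbers as states.\<close>
lemma logspace_computable_translate_output:
  assumes f: "logspace_computable X Y f" and "finite Z"
    and Q: "finite Q" "r \<in> Q"
    and d: "\<And>s y. s \<in> Q \<Longrightarrow> y \<in> Y \<Longrightarrow> d s y \<in> Q"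
    and u: "\<And>s y. s \<in> Q \<Longrightarrow> y \<in> Y \<Longrightarrow> u s y \<in> lists Z"
  shows "logspace_computable X Z (\<lambda>w. translate d u r (f w))"
proof -
  obtain M where wf: "wf_transducer X Y M" and bd: "logspace_bounded X M"
    and out: "\<And>w. w \<in> lists X \<Longrightarrow> outputs M w (f w)"
    using f unfolding logspace_computable_def by blast
  define S where "S = states M \<times> Q"
  have "finite S" using wf Q by (auto simp: S_def wf_transducer_def)
  define e where "e = to_nat_on S"
  have dec: "from_nat_into S (e p) = p" if "p \<in> S" for p
    using that \<open>finite S\<close> by (simp add: e_def countable_finite)
  define N where "N = \<lparr>states = e ` S, start = e (start M, r), final = e ` (final M \<times> Q),
    work_symbols = work_symbols M, blank = blank M,
    delta = (\<lambda>p a b. case from_nat_into S p of (q, s) \<Rightarrow>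
      (case delta M q a b of (q', b', mw, mi, v) \<Rightarrow>
        (e (q', foldl d s v), b', mw, mi, translate d u s v)))\<rparr>"
  have wfN: "wf_transducer X Z N"
  proof -
    have "case delta N p a b of (p', b', mw, mi, v) \<Rightarrow>
        p' \<in> states N \<and> b' \<in> work_symbols N \<and> v \<in> lists Z"
      if "p \<in> states N" "a \<in> input_symbols X" "b \<in> work_symbols N" for p a b
    proof -
      have "p \<in> e ` S" using that(1) by (simp add: N_def)
      then obtain q s where p: "p = e (q, s)" and qs: "(q, s) \<in> S"
        by (elim imageE) (metis surj_pair)
      obtain q' b' mw mi v where D: "delta M q a b = (q', b', mw, mi, v)"
        by (metis prod_cases5)
      have q: "q \<in> states M" "s \<in> Q" "b \<in> work_symbols M"
        using qs that(3) by (auto simp: S_def N_def)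
      then have *: "q' \<in> states M" "b' \<in> work_symbols M" "v \<in> lists Y"
        using wf_transducer_delta[OF wf _ that(2) _ D] by simp_all
      have "foldl d s v \<in> Q" "translate d u s v \<in> lists Z"
        using foldl_closed[of Q Y d, OF d q(2) *(3)] translate_in_lists[of Q Y d u, OF d u q(2) *(3)] by auto
      with * show ?thesis
        by (simp add: N_def p dec[OF qs] D) (auto simp: S_def)
    qed
    then show ?thesis
      using wf Q \<open>finite Z\<close> \<open>finite S\<close>
      unfolding wf_transducer_def by (auto simp: N_def S_def)
  qed
  have inv: "config_at N w t =
      \<lparr>state = e (state (config_at M w t), foldl d r (written (config_at M w t))),
       input_pos = input_pos (config_at M w t), work_tape = work_tape (config_at M w t),
       work_pos = work_pos (config_at M w t),
       written = translate d u r (written (config_at M w t))\<rparr>"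
    and inS: "(state (config_at M w t), foldl d r (written (config_at M w t))) \<in> S"
    if w: "w \<in> lists X" for w t
  proof -
    show inS: "(state (config_at M w t), foldl d r (written (config_at M w t))) \<in> S" for t
      using config_at_wf[OF wf w] foldl_closed[of Q Y d, OF d Q(2)] by (auto simp: S_def)
    show "config_at N w t =
      \<lparr>state = e (state (config_at M w t), foldl d r (written (config_at M w t))),
       input_pos = input_pos (config_at M w t), work_tape = work_tape (config_at M w t),
       work_pos = work_pos (config_at M w t),
       written = translate d u r (written (config_at M w t))\<rparr>"
    proof (induction t)
      case 0
      show ?case by (simp add: config_at_0 initial_config_def N_def)
    next
      case (Suc t)
      define C where "C = config_at M w t"
      have CS: "(state C, foldl d r (written C)) \<in> S"
        using inS by (simp add: C_def)
      have fin: "e (state C, foldl d r (written C)) \<in> final N \<longleftrightarrow> state C \<in> final M"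
      proof
        assume "e (state C, foldl d r (written C)) \<in> final N"
        then obtain p where p: "p \<in> final M \<times> Q" "e (state C, foldl d r (written C)) = e p"
          by (auto simp: N_def)
        then have "p \<in> S" using wf by (auto simp: S_def wf_transducer_def)
        then have "p = (state C, foldl d r (written C))"
          using dec[of p] dec[OF CS] p(2) by simp
        then show "state C \<in> final M" using p by auto
      qed (use CS in \<open>auto simp: N_def S_def\<close>)
      obtain q' b' mw mi v where
        D: "delta M (state C) (scan w (input_pos C)) (work_tape C (work_pos C)) = (q', b', mw, mi, v)"
        by (metis prod_cases5)
      show ?case
        unfolding config_at_Suc Suc C_def[symmetric]
      proof (cases "state C \<in> final M")
        case True
        then show "step N w \<lparr>state = e (state C, foldl d r (written C)), input_pos = input_pos C,
            work_tape = work_tape C, work_pos = work_pos C, written = translate d u r (written C)\<rparr> =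
          \<lparr>state = e (state (step M w C), foldl d r (written (step M w C))),
            input_pos = input_pos (step M w C), work_tape = work_tape (step M w C),
            work_pos = work_pos (step M w C), written = translate d u r (written (step M w C))\<rparr>"
          using fin by (simp add: step_def)
      next
        case False
        have "delta N (e (state C, foldl d r (written C))) (scan w (input_pos C)) (work_tape C (work_pos C))
          = (e (q', foldl d (foldl d r (written C)) v), b', mw, mi, translate d u (foldl d r (written C)) v)"
          by (simp add: N_def dec[OF CS] D)
        with False show "step N w \<lparr>state = e (state C, foldl d r (written C)), input_pos = input_pos C,
            work_tape = work_tape C, work_pos = work_pos C, written = translate d u r (written C)\<rparr> =
          \<lparr>state = e (state (step M w C), foldl d r (written (step M w C))),
            input_pos = input_pos (step M w C), work_tape = work_tape (step M w C),
            work_pos = work_pos (step M w C), written = translate d u r (written (step M w C))\<rparr>"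
          using fin by (simp add: step_def D translate_append)
      qed
    qed
  qed
  have "logspace_bounded X N"
    using bd unfolding logspace_bounded_def by (auto simp: inv)
  moreover have "outputs N w (translate d u r (f w))" if w: "w \<in> lists X" for w
  proof -
    obtain t where t: "state (config_at M w t) \<in> final M" "written (config_at M w t) = f w"
      using out[OF w] unfolding outputs_def by blast
    have "foldl d r (written (config_at M w t)) \<in> Q"
      using inS[OF w, of t] by (simp add: S_def)
    then have "state (config_at N w t) \<in> final N"
      unfolding inv[OF w] using t by (simp add: N_def)
    then show ?thesis
      unfolding outputs_def using t by (intro exI[of _ t]) (simp add: inv[OF w])
  qed
  ultimately show ?thesis
    using wfN unfolding logspace_computable_def by blast
qed


section \<open>Translating the input\<close>

text \<open>The input tape with its end markers. The end markers are translated to themselves, so that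
  below they need no separate treatment.\<close>
definition marked :: "'x list \<Rightarrow> 'x input_symbol list" where
  "marked w = Left_End # map Letter w @ [Right_End]"

lemma length_marked [simp]: "length (marked w) = length w + 2"
  by (simp add: marked_def)

lemma scan_marked: "i \<le> length w + 1 \<Longrightarrow> scan w i = marked w ! i"
  by (auto simp: scan_def marked_def nth_Cons nth_append split: nat.split)

lemma scan_eq_Right_End_iff: "scan w i = Right_End \<longleftrightarrow> length w < i"
  by (auto simp: scan_def)

text \<open>
  A cursor, together with the position of the head on a letter of the original word, describes a
  position on the translated word. \<open>From_Left s j\<close> is the \<open>j\<close>-th symbol of the block to which that
  letter is translated, where \<open>s\<close> is the state before the letter. \<open>From_Right s\<close> is the last symbol of
  the block, where \<open>s\<close> is the state after the letter. The second form is needed when the head has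
  just entered the letter from the right: the letter has not been read, so neither the length of
  its block nor the state before it is known yet.
\<close>
datatype 's cursor = From_Left 's nat | From_Right 's

text \<open>Reversibility lets the state before a letter be recovered from the state after it.\<close>
locale reversible_translation =
  fixes X :: "'x set" and Y :: "'y set" and Q :: "'s set" and r :: 's
    and d :: "'s \<Rightarrow> 'x \<Rightarrow> 's" and u :: "'s \<Rightarrow> 'x \<Rightarrow> 'y list"
  assumes finite_X: "finite X" and finite_Q: "finite Q" and start_in_Q: "r \<in> Q"
    and reversible: "x \<in> X \<Longrightarrow> bij_betw (\<lambda>s. d s x) Q Q"
    and block_in_lists: "s \<in> Q \<Longrightarrow> x \<in> X \<Longrightarrow> u s x \<in> lists Y"
    and block_nonempty: "s \<in> Q \<Longrightarrow> x \<in> X \<Longrightarrow> u s x \<noteq> []"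
begin

fun next_state :: "'s \<Rightarrow> 'x input_symbol \<Rightarrow> 's" where
  "next_state s (Letter x) = d s x"
| "next_state s _ = s"

fun block :: "'s \<Rightarrow> 'x input_symbol \<Rightarrow> 'y input_symbol list" where
  "block s (Letter x) = map Letter (u s x)"
| "block s Left_End = [Left_End]"
| "block s Right_End = [Right_End]"

definition previous_state :: "'s \<Rightarrow> 'x input_symbol \<Rightarrow> 's" where
  "previous_state s a = inv_into Q (\<lambda>s. next_state s a) s"

text \<open>The block of an end marker has length 1, whence the 1 in the maximum; it also makes the maximum
  defined when there are no blocks.\<close>
definition max_block :: nat where
  "max_block = Max (insert 1 ((\<lambda>(s, x). length (u s x)) ` (Q \<times> X)))"

lemma next_state_bij: "a \<in> input_symbols X \<Longrightarrow> bij_betw (\<lambda>s. next_state s a) Q Q"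
  unfolding input_symbols_def
  by (elim UnE imageE) (auto simp: reversible bij_betw_def[of "\<lambda>s. s"])

lemma next_state_in_Q: "a \<in> input_symbols X \<Longrightarrow> s \<in> Q \<Longrightarrow> next_state s a \<in> Q"
  using bij_betw_apply[OF next_state_bij] .

lemma d_in_Q: "s \<in> Q \<Longrightarrow> x \<in> X \<Longrightarrow> d s x \<in> Q"
  using bij_betw_apply[OF reversible] .

lemma previous_state_in_Q: "a \<in> input_symbols X \<Longrightarrow> s \<in> Q \<Longrightarrow> previous_state s a \<in> Q"
  unfolding previous_state_def by (rule inv_into_into) (use next_state_bij in \<open>auto simp: bij_betw_def\<close>)

lemma previous_next_state:
  "a \<in> input_symbols X \<Longrightarrow> s \<in> Q \<Longrightarrow> previous_state (next_state s a) a = s"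
  unfolding previous_state_def by (rule bij_betw_inv_into_left[OF next_state_bij])

lemma block_not_Nil: "a \<in> input_symbols X \<Longrightarrow> s \<in> Q \<Longrightarrow> block s a \<noteq> []"
  using block_nonempty by (auto simp: input_symbols_def)

lemma block_symbols: "a \<in> input_symbols X \<Longrightarrow> s \<in> Q \<Longrightarrow> set (block s a) \<subseteq> input_symbols Y"
  using block_in_lists by (fastforce simp: input_symbols_def in_lists_conv_set)

lemma length_u_le: "s \<in> Q \<Longrightarrow> x \<in> X \<Longrightarrow> length (u s x) \<le> max_block"
  unfolding max_block_def by (rule Max_ge) (use finite_Q finite_X in auto)

lemma max_block_ge_1: "1 \<le> max_block"
  unfolding max_block_def by (rule Max_ge) (use finite_Q finite_X in auto)

lemma length_block_le: "a \<in> input_symbols X \<Longrightarrow> s \<in> Q \<Longrightarrow> length (block s a) \<le> max_block"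
  using length_u_le max_block_ge_1 by (auto simp: input_symbols_def)

lemma translate_marked:
  "translate next_state block s (marked w) = marked (translate d u s w)"
proof -
  have "translate next_state block s (map Letter w @ [Right_End]) =
    map Letter (translate d u s w) @ [Right_End]" for s
    by (induction w arbitrary: s) auto
  then show ?thesis by (simp add: marked_def)
qed

definition state_at :: "'x list \<Rightarrow> nat \<Rightarrow> 's" where
  "state_at w i = foldl next_state r (take i (marked w))"

definition offset :: "'x list \<Rightarrow> nat \<Rightarrow> nat" where
  "offset w i = length (translate next_state block r (take i (marked w)))"

lemma state_at_0: "state_at w 0 = r"
  by (simp add: state_at_def)

lemma offset_0: "offset w 0 = 0"
  by (simp add: offset_def)

lemma take_Suc_marked:
  "i \<le> length w + 1 \<Longrightarrow> take (Suc i) (marked w) = take i (marked w) @ [scan w i]"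
  by (simp add: take_Suc_conv_app_nth scan_marked)

lemma state_at_Suc:
  "i \<le> length w + 1 \<Longrightarrow> state_at w (Suc i) = next_state (state_at w i) (scan w i)"
  by (simp add: state_at_def take_Suc_marked)

lemma offset_Suc:
  "i \<le> length w + 1 \<Longrightarrow> offset w (Suc i) = offset w i + length (block (state_at w i) (scan w i))"
  by (simp add: state_at_def offset_def take_Suc_marked translate_append)

lemma offset_end: "offset w (length w + 2) = length (translate d u r w) + 2"
  by (simp add: offset_def translate_marked)

lemma state_at_in_Q:
  assumes "w \<in> lists X" shows "i \<le> length w + 2 \<Longrightarrow> state_at w i \<in> Q"
  by (induction i)
    (use start_in_Q next_state_in_Q scan_in_input_symbols[OF assms] in \<open>auto simp: state_at_0 state_at_Suc\<close>)

lemma state_at_end: "state_at w (length w + 1) = foldl d r w"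
proof -
  have "foldl next_state s (map Letter w) = foldl d s w" for s
    by (induction w arbitrary: s) auto
  then show ?thesis by (simp add: state_at_def marked_def)
qed

lemma offset_mono: "j \<le> length w + 2 \<Longrightarrow> i \<le> j \<Longrightarrow> offset w i \<le> offset w j"
proof (induction j)
  case (Suc j)
  then show ?case
    by (cases "i = Suc j") (auto simp: offset_Suc)
qed auto

text \<open>Symbol \<open>j\<close> of the block of the symbol under position \<open>i\<close> is found on the translated tape
  at position \<open>offset w i + j\<close>, since the preceding blocks have total length \<open>offset w i\<close>.\<close>
lemma scan_translate:
  assumes "i \<le> length w + 1" "j < length (block (state_at w i) (scan w i))"
  shows "offset w i + j \<le> length (translate d u r w) + 1"
    and "scan (translate d u r w) (offset w i + j) = block (state_at w i) (scan w i) ! j"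
proof -
  have "offset w i + j < offset w (Suc i)"
    using assms by (simp add: offset_Suc)
  also have "\<dots> \<le> length (translate d u r w) + 2"
    using offset_mono[of "length w + 2" w "Suc i"] assms by (simp add: offset_end[simplified])
  finally show le: "offset w i + j \<le> length (translate d u r w) + 1" by simp
  have "marked w = take i (marked w) @ scan w i # drop (Suc i) (marked w)"
    using assms(1) by (simp add: scan_marked id_take_nth_drop)
  then have "marked (translate d u r w) = translate next_state block r (take i (marked w)) @
      block (state_at w i) (scan w i) @
      translate next_state block (next_state (state_at w i) (scan w i)) (drop (Suc i) (marked w))"
    unfolding translate_marked[symmetric] state_at_def by (metis translate_append translate.simps(2))
  then have "marked (translate d u r w) ! (offset w i + j) = block (state_at w i) (scan w i) ! j"
    using assms(2) by (simp add: offset_def nth_append)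
  then show "scan (translate d u r w) (offset w i + j) = block (state_at w i) (scan w i) ! j"
    using scan_marked[OF le] by simp
qed

fun points_to :: "'x list \<Rightarrow> nat \<Rightarrow> 's cursor \<Rightarrow> nat \<Rightarrow> bool" where
  "points_to w i (From_Left s j) p \<longleftrightarrow>
     s = state_at w i \<and> j < length (block s (scan w i)) \<and> p = offset w i + j"
| "points_to w i (From_Right s) p \<longleftrightarrow> s = state_at w (Suc i) \<and> p = offset w (Suc i) - 1"

text \<open>Once the letter \<open>a\<close> has been read, both forms of a cursor can be resolved to the state before the
  letter and an index into its block. The minimum only serves to keep the index in range for
  cursors that do not occur in a computation.\<close>
fun locate :: "'s cursor \<Rightarrow> 'x input_symbol \<Rightarrow> 's \<times> nat" where
  "locate (From_Left s j) a = (s, min j (length (block s a) - 1))"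
| "locate (From_Right s) a =
     (previous_state s a, length (block (previous_state s a) a) - 1)"

text \<open>How the cursor changes and where the head on the original word goes when the head on the
  translated word moves.\<close>
fun move_cursor ::
    "head_move \<Rightarrow> 's \<Rightarrow> nat \<Rightarrow> 'x input_symbol \<Rightarrow> 's cursor \<times> head_move" where
  "move_cursor Go_Right s j a =
     (if j + 1 < length (block s a) then (From_Left s (j + 1), Stay)
      else (From_Left (next_state s a) 0, Go_Right))"
| "move_cursor Stay s j a = (From_Left s j, Stay)"
| "move_cursor Go_Left s j a =
     (if j > 0 then (From_Left s (j - 1), Stay) else (From_Right s, Go_Left))"

lemma locate_points_to:
  assumes "w \<in> lists X" "i \<le> length w + 1" "points_to w i k p"
  shows "\<exists>j. locate k (scan w i) = (state_at w i, j) \<and>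
    j < length (block (state_at w i) (scan w i)) \<and> p = offset w i + j"
proof -
  have Q: "state_at w i \<in> Q" using state_at_in_Q[OF assms(1)] assms(2) by simp
  have a: "scan w i \<in> input_symbols X" using scan_in_input_symbols[OF assms(1)] .
  obtain b bs where "block (state_at w i) (scan w i) = b # bs"
    using block_not_Nil[OF a Q] by (auto simp: neq_Nil_conv)
  then show ?thesis
    using assms(2,3)
    by (cases k) (auto simp: state_at_Suc offset_Suc previous_next_state[OF a Q])
qed

text \<open>One move on the translated tape is matched by at most one move on the original tape because
  blocks are nonempty. At the two ends, both heads are held back; the cursor stays correct there
  since an end marker is a block of length 1 and does not change the state.\<close>
lemma move_cursor_points_to:
  assumes w: "w \<in> lists X" and i: "i \<le> length w + 1"
    and j: "j < length (block (state_at w i) (scan w i))"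
    and mv: "move_cursor m (state_at w i) j (scan w i) = (k, m')"
  shows "points_to w (min (length w + 1) (move_head m' i)) k
    (min (length (translate d u r w) + 1) (move_head m (offset w i + j)))"
proof -
  define a where "a = scan w i"
  have Q: "state_at w i \<in> Q" using state_at_in_Q[OF w] i by simp
  have a: "a \<in> input_symbols X" using scan_in_input_symbols[OF w] by (simp add: a_def)
  have le: "offset w i + j \<le> length (translate d u r w) + 1"
    using scan_translate(1)[OF i j] .
  show ?thesis
  proof (cases m)
    case Stay
    then show ?thesis using mv i j le by (auto simp: min_absorb2)
  next
    case Go_Right
    show ?thesis
    proof (cases "j + 1 < length (block (state_at w i) a)")
      case True
      then have "offset w i + (j + 1) \<le> length (translate d u r w) + 1"
        using scan_translate(1)[OF i, of "j + 1"] by (simp add: a_def)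
      then show ?thesis using Go_Right True mv i by (auto simp: a_def min_absorb2)
    next
      case False
      then have k: "k = From_Left (state_at w (Suc i)) 0" "m' = Go_Right"
        and off: "offset w (Suc i) = offset w i + j + 1"
        using Go_Right mv j i by (auto simp: a_def state_at_Suc offset_Suc)
      show ?thesis
      proof (cases "i = length w + 1")
        case True
        \<comment> \<open>the head is at the right end and cannot leave it\<close>
        then have "a = Right_End" by (simp add: a_def scan_eq_Right_End_iff)
        then have "state_at w (Suc i) = state_at w i" "j = 0"
          using state_at_Suc[OF i] j by (auto simp: a_def)
        moreover have "offset w i = length (translate d u r w) + 1"
          using off True \<open>j = 0\<close> offset_end[of w] by simp
        ultimately show ?thesis
          using k True Go_Right j by simp
      next
        case False
        then have i': "Suc i \<le> length w + 1" using i by simp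
        have "block (state_at w (Suc i)) (scan w (Suc i)) \<noteq> []"
          using block_not_Nil scan_in_input_symbols[OF w] state_at_in_Q[OF w] i' by simp
        moreover from this have "offset w (Suc i) + 0 \<le> length (translate d u r w) + 1"
          by (intro scan_translate(1)[OF i']) simp
        ultimately show ?thesis
          using k i' Go_Right off by (simp add: min_absorb2)
      qed
    qed
  next
    case Go_Left
    show ?thesis
    proof (cases "j > 0")
      case True
      then show ?thesis using Go_Left mv i j le by (auto simp: min_absorb2)
    next
      case False
      then have k: "k = From_Right (state_at w i)" "m' = Go_Left"
        using Go_Left mv by auto
      show ?thesis
      proof (cases i)
        case 0
        \<comment> \<open>the head is at the left end and cannot leave it\<close>
        then have "a = Left_End" by (simp add: a_def scan_def)
        then show ?thesis
          using k 0 Go_Left False state_at_Suc[of 0 w] offset_Suc[of 0 w]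
          by (simp add: a_def offset_0)
      next
        case (Suc i')
        then show ?thesis using k Go_Left False i le by (simp add: min_absorb2)
      qed
    qed
  qed
qed


section \<open>Simulating a machine on the translated word\<close>

definition cursors :: "'s cursor set" where
  "cursors = (\<lambda>(s, j). From_Left s j) ` (Q \<times> {..max_block}) \<union> From_Right ` Q"

text \<open>\<open>None\<close> is the halting state. It differs from the final states of the given machine because,
  once that machine has halted, the head still has to walk to the right end of the input to learn
  the last state of the translation.\<close>
definition run_states :: "('y, 'z) transducer \<Rightarrow> (nat \<times> 's cursor) option set" where
  "run_states M = insert None (Some ` (states M \<times> cursors))"

definition code :: "('y, 'z) transducer \<Rightarrow> (nat \<times> 's cursor) option \<Rightarrow> nat" where
  "code M = to_nat_on (run_states M)"

definition run_delta :: "('y, 'z) transducer \<Rightarrow> ('s \<Rightarrow> 'z list) \<Rightarrow> (nat \<times> 's cursor) option \<Rightarrow>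
    'x input_symbol \<Rightarrow> nat \<Rightarrow> (nat \<times> 's cursor) option \<times> nat \<times> head_move \<times> head_move \<times> 'z list" where
  "run_delta M z P a b = (case P of
     None \<Rightarrow> (None, b, Stay, Stay, [])
   | Some (q, k) \<Rightarrow> (case locate k a of (s, j) \<Rightarrow>
       if q \<in> final M then
         (if a = Right_End then (None, b, Stay, Stay, z s)
          else (Some (q, From_Left (next_state s a) 0), b, Stay, Go_Right, []))
       else (case delta M q (block s a ! j) b of (q', b', mw, mi, v) \<Rightarrow>
         case move_cursor mi s j a of (k', mi') \<Rightarrow> (Some (q', k'), b', mw, mi', v))))"

definition composite :: "('y, 'z) transducer \<Rightarrow> ('s \<Rightarrow> 'z list) \<Rightarrow> ('x, 'z) transducer" where
  "composite M z = \<lparr>states = code M ` run_states M,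
     start = code M (Some (start M, From_Left r 0)), final = {code M None},
     work_symbols = work_symbols M, blank = blank M,
     delta = (\<lambda>p a b. case run_delta M z (from_nat_into (run_states M) p) a b of
       (P, b', mw, mi, v) \<Rightarrow> (code M P, b', mw, mi, v))\<rparr>"

lemma locate_in_range:
  assumes "k \<in> cursors" "a \<in> input_symbols X" "locate k a = (s, j)"
  shows "s \<in> Q" "j < length (block s a)"
proof -
  show "s \<in> Q"
    using assms previous_state_in_Q by (auto simp: cursors_def)
  then have "block s a \<noteq> []" using block_not_Nil assms(2) by simp
  then have "0 < length (block s a)" by simp
  moreover have "j \<le> length (block s a) - 1"
    using assms(3) by (cases k) auto
  ultimately show "j < length (block s a)" by linarith
qed

lemma move_cursor_in_cursors:
  assumes "s \<in> Q" "a \<in> input_symbols X" "j < length (block s a)" "move_cursor m s j a = (k, m')"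
  shows "k \<in> cursors"
proof -
  have "length (block s a) \<le> max_block" using length_block_le assms(1,2) by simp
  then show ?thesis
    using assms next_state_in_Q[OF assms(2,1)]
    by (cases m) (force simp: cursors_def split: if_splits)+
qed

lemma points_to_in_cursors:
  assumes w: "w \<in> lists X" and i: "i \<le> length w + 1" and "points_to w i k p"
  shows "k \<in> cursors"
proof -
  have "state_at w i \<in> Q" "state_at w (Suc i) \<in> Q"
    using state_at_in_Q[OF w] i by simp_all
  moreover have "length (block (state_at w i) (scan w i)) \<le> max_block"
    using length_block_le[OF scan_in_input_symbols[OF w]] \<open>state_at w i \<in> Q\<close> .
  ultimately show ?thesis
    using assms(3) by (cases k) (auto simp: cursors_def image_iff)
qed

lemma finite_run_states:
  assumes "wf_transducer Y Z M" shows "finite (run_states M)"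
  using assms finite_Q by (simp add: run_states_def cursors_def wf_transducer_def)

lemma decode:
  assumes "wf_transducer Y Z M" "P \<in> run_states M"
  shows "from_nat_into (run_states M) (code M P) = P"
  using assms by (simp add: code_def finite_run_states countable_finite)

lemma code_eq_None_iff:
  assumes "wf_transducer Y Z M" "P \<in> run_states M"
  shows "code M P = code M None \<longleftrightarrow> P = None"
proof -
  have "None \<in> run_states M" by (simp add: run_states_def)
  then show ?thesis using decode[OF assms(1)] assms(2) by metis
qed

lemma run_delta_wf:
  assumes wf: "wf_transducer Y Z M" and z: "\<And>s. s \<in> Q \<Longrightarrow> z s \<in> lists Z'" and "Z \<subseteq> Z'"
    and P: "P \<in> run_states M" and a: "a \<in> input_symbols X" and b: "b \<in> work_symbols M"
    and D: "run_delta M z P a b = (P', b', mw, mi, v)"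
  shows "P' \<in> run_states M" "b' \<in> work_symbols M" "v \<in> lists Z'"
proof -
  have "P' \<in> run_states M \<and> b' \<in> work_symbols M \<and> v \<in> lists Z'"
  proof (cases P)
    case None
    then show ?thesis using D P b by (auto simp: run_delta_def)
  next
    case (Some p)
    then obtain q k where p: "P = Some (q, k)" by (cases p) auto
    have q: "q \<in> states M" and k: "k \<in> cursors"
      using P p by (auto simp: run_states_def)
    obtain s j where l: "locate k a = (s, j)" by fastforce
    note s = locate_in_range[OF k a l]
    show ?thesis
    proof (cases "q \<in> final M")
      case True
      then show ?thesis
        using D p l q b z[OF s(1)] next_state_in_Q[OF a s(1)]
        by (auto simp: run_delta_def run_states_def cursors_def split: if_splits)
    next
      case False
      obtain q' b1 mw' mi1 v' where d: "delta M q (block s a ! j) b = (q', b1, mw', mi1, v')"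
        by (metis prod_cases5)
      obtain k' mi' where m: "move_cursor mi1 s j a = (k', mi')" by fastforce
      have "block s a ! j \<in> input_symbols Y"
        using block_symbols[OF a s(1)] s(2) by auto
      note wf_transducer_delta[OF wf q this b d]
      moreover have "k' \<in> cursors"
        using move_cursor_in_cursors[OF s(1) a s(2) m] .
      moreover have "P' = Some (q', k')" "b' = b1" "v = v'"
        using D p l False d m by (auto simp: run_delta_def)
      ultimately show ?thesis
        using \<open>Z \<subseteq> Z'\<close> by (auto simp: run_states_def)
    qed
  qed
  then show "P' \<in> run_states M" "b' \<in> work_symbols M" "v \<in> lists Z'" by auto
qed

lemma wf_composite:
  assumes wf: "wf_transducer Y Z M" and z: "\<And>s. s \<in> Q \<Longrightarrow> z s \<in> lists Z'"
    and "Z \<subseteq> Z'" "finite Z'"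
  shows "wf_transducer X Z' (composite M z)"
proof -
  have start: "Some (start M, From_Left r 0) \<in> run_states M"
    using wf start_in_Q by (auto simp: run_states_def cursors_def wf_transducer_def)
  have "case delta (composite M z) p a b of (p', b', mw, mi, v) \<Rightarrow>
      p' \<in> states (composite M z) \<and> b' \<in> work_symbols (composite M z) \<and> v \<in> lists Z'"
    if hyp: "p \<in> states (composite M z)" "a \<in> input_symbols X" "b \<in> work_symbols (composite M z)"
    for p a b
  proof -
    have "p \<in> code M ` run_states M" using hyp(1) by (simp add: composite_def)
    then obtain P where p: "p = code M P" and P: "P \<in> run_states M" by (elim imageE)
    obtain P' b' mw mi v where D: "run_delta M z P a b = (P', b', mw, mi, v)"
      by (metis prod_cases5)
    have b: "b \<in> work_symbols M" using hyp(3) by (simp add: composite_def)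
    from run_delta_wf[OF wf z \<open>Z \<subseteq> Z'\<close> P hyp(2) b D]
    show ?thesis by (simp add: composite_def p decode[OF wf P] D)
  qed
  then show ?thesis
    using wf start finite_X \<open>finite Z'\<close> finite_run_states[OF wf]
    unfolding wf_transducer_def by (simp add: composite_def) (simp add: run_states_def)
qed

text \<open>The invariant between a configuration of the given machine on the translated word and one
  of the composite machine on \<open>w\<close>. During the final walk the position \<open>p\<close> of the cursor is no
  longer tied to the head of the given machine, which has halted, but the cursor still carries the
  right state of the translation.\<close>
definition simulates ::
    "('y, 'z) transducer \<Rightarrow> ('s \<Rightarrow> 'z list) \<Rightarrow> 'x list \<Rightarrow> 'z configuration \<Rightarrow> 'z configuration \<Rightarrow> bool" where
  "simulates M z w C C' \<longleftrightarrow>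
     work_pos C' = work_pos C \<and> work_tape C' = work_tape C \<and> input_pos C' \<le> length w + 1 \<and>
     (state C' = code M None \<and> state C \<in> final M \<and> written C' = written C @ z (foldl d r w) \<or>
      (\<exists>k p. state C' = code M (Some (state C, k)) \<and> written C' = written C \<and>
         points_to w (input_pos C') k p \<and> (state C \<notin> final M \<longrightarrow> p = input_pos C)))"

lemma step_composite:
  assumes wf: "wf_transducer Y Z M" and P: "P \<in> run_states M" "P \<noteq> None"
    and C: "state C = code M P"
    and D: "run_delta M z P (scan w (input_pos C)) (work_tape C (work_pos C)) = (P', b', mw, mi, v)"
  shows "step (composite M z) w C = \<lparr>state = code M P',
    input_pos = min (length w + 1) (move_head mi (input_pos C)),
    work_tape = (work_tape C)(work_pos C := b'), work_pos = move_head mw (work_pos C),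
    written = written C @ v\<rparr>"
proof -
  have "state C \<notin> final (composite M z)"
    using code_eq_None_iff[OF wf P(1)] P(2) C by (simp add: composite_def)
  moreover have "delta (composite M z) (state C) (scan w (input_pos C)) (work_tape C (work_pos C))
    = (code M P', b', mw, mi, v)"
    by (simp add: composite_def C decode[OF wf P(1)] D)
  ultimately show ?thesis by (simp add: step_def)
qed

text \<open>The second part says that the final walk makes progress.\<close>
lemma simulates_step:
  assumes wf: "wf_transducer Y Z M" and w: "w \<in> lists X"
    and q: "state C \<in> states M" and sim: "simulates M z w C C'"
  shows "simulates M z w (step M (translate d u r w) C) (step (composite M z) w C')"
    and "state C \<in> final M \<Longrightarrow> state (step (composite M z) w C') = code M None \<or>
      input_pos C' \<le> length w \<and> input_pos (step (composite M z) w C') = Suc (input_pos C')"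
proof -
  let ?A = "simulates M z w (step M (translate d u r w) C) (step (composite M z) w C')"
  let ?B = "state C \<in> final M \<longrightarrow> state (step (composite M z) w C') = code M None \<or>
      input_pos C' \<le> length w \<and> input_pos (step (composite M z) w C') = Suc (input_pos C')"
  have "?A \<and> ?B"
  proof (cases "state C' = code M None \<and> state C \<in> final M \<and> written C' = written C @ z (foldl d r w)")
    case True
    moreover from this have "step (composite M z) w C' = C'"
      by (intro step_final) (simp add: composite_def)
    moreover have "step M (translate d u r w) C = C"
      using True by (intro step_final) simp
    ultimately show ?thesis using sim by simp
  next
    case False
    define i where "i = input_pos C'"
    define a where "a = scan w i"
    obtain k p where k: "state C' = code M (Some (state C, k))" "written C' = written C"
        "points_to w i k p" "state C \<notin> final M \<longrightarrow> p = input_pos C"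
      and wp: "work_pos C' = work_pos C" and wt: "work_tape C' = work_tape C"
      and i: "i \<le> length w + 1"
      using sim False unfolding simulates_def i_def by blast
    have P: "Some (state C, k) \<in> run_states M"
      using q points_to_in_cursors[OF w i k(3)] by (simp add: run_states_def)
    obtain j where l: "locate k a = (state_at w i, j)"
      and j: "j < length (block (state_at w i) a)" "p = offset w i + j"
      using locate_points_to[OF w i k(3)] by (auto simp: a_def)
    show ?thesis
    proof (cases "state C \<in> final M")
      case True
      have st: "step M (translate d u r w) C = C"
        using True by (rule step_final)
      show ?thesis
      proof (cases "a = Right_End")
        case end_marker: True
        then have "i = length w + 1" using i by (simp add: a_def scan_eq_Right_End_iff)
        then have "state_at w i = foldl d r w" using state_at_end by simp
        then have "run_delta M z (Some (state C, k)) (scan w (input_pos C')) (work_tape C' (work_pos C'))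
          = (None, work_tape C' (work_pos C'), Stay, Stay, z (foldl d r w))"
          using True end_marker l by (simp add: run_delta_def a_def i_def)
        note step_composite[OF wf P _ k(1) this]
        then show ?thesis
          using True wp wt k(2) i unfolding st by (simp add: simulates_def)
      next
        case letter: False
        then have i': "Suc i \<le> length w + 1" using i by (simp add: a_def scan_eq_Right_End_iff)
        have "run_delta M z (Some (state C, k)) (scan w (input_pos C')) (work_tape C' (work_pos C'))
          = (Some (state C, From_Left (state_at w (Suc i)) 0), work_tape C' (work_pos C'), Stay, Go_Right, [])"
          using True letter l state_at_Suc[OF i] by (simp add: run_delta_def a_def i_def)
        note N = step_composite[OF wf P _ k(1) this]
        have "state_at w (Suc i) \<in> Q" using state_at_in_Q[OF w] i' by simp
        then have "block (state_at w (Suc i)) (scan w (Suc i)) \<noteq> []"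
          using block_not_Nil[OF scan_in_input_symbols[OF w]] by simp
        then have "points_to w (Suc i) (From_Left (state_at w (Suc i)) 0) (offset w (Suc i))"
          by simp
        then have ?A
          using True wp wt k(2) i' N unfolding st
          by (fastforce simp: simulates_def i_def[symmetric] min_absorb2)
        moreover have ?B using N i' by (simp add: i_def)
        ultimately show ?thesis by blast
      qed
    next
      case False
      define b where "b = work_tape C (work_pos C)"
      have p: "input_pos C = offset w i + j" using False k(4) j(2) by simp
      have a: "scan (translate d u r w) (input_pos C) = block (state_at w i) a ! j"
        using scan_translate(2)[OF i, of j] j(1) by (simp add: p a_def)
      obtain q' b' mw mi v where D: "delta M (state C) (block (state_at w i) a ! j) b = (q', b', mw, mi, v)"
        by (metis prod_cases5)
      obtain k' mi' where m: "move_cursor mi (state_at w i) j a = (k', mi')" by fastforce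
      have "run_delta M z (Some (state C, k)) (scan w (input_pos C')) (work_tape C' (work_pos C'))
          = (Some (q', k'), b', mw, mi', v)"
        using False l D m by (simp add: run_delta_def a_def i_def wp wt b_def)
      note N = step_composite[OF wf P _ k(1) this]
      have "points_to w (min (length w + 1) (move_head mi' i)) k'
          (min (length (translate d u r w) + 1) (move_head mi (input_pos C)))"
        unfolding p by (rule move_cursor_points_to[OF w i]) (use j m in \<open>simp_all add: a_def\<close>)
      then have ?A
        using False wp wt k(2) N D
        by (simp add: simulates_def step_def a b_def i_def[symmetric]) blast
      then show ?thesis using False by blast
    qed
  qed
  then show ?A "state C \<in> final M \<Longrightarrow> state (step (composite M z) w C') = code M None \<or>
      input_pos C' \<le> length w \<and> input_pos (step (composite M z) w C') = Suc (input_pos C')"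
    by blast+
qed

lemma translate_Y: "w \<in> lists X \<Longrightarrow> translate d u r w \<in> lists Y"
  using translate_in_lists[of Q X d u, OF d_in_Q block_in_lists start_in_Q] .

lemma simulates_config_at:
  assumes wf: "wf_transducer Y Z M" and w: "w \<in> lists X"
  shows "simulates M z w (config_at M (translate d u r w) t) (config_at (composite M z) w t)"
proof (induction t)
  case 0
  have "scan w 0 = Left_End" by (simp add: scan_def)
  then have "points_to w 0 (From_Left r 0) 0"
    by (simp add: state_at_0 offset_0)
  then show ?case
    by (auto simp: simulates_def config_at_0 initial_config_def composite_def)
next
  case (Suc t)
  then show ?case
    unfolding config_at_Suc
    by (intro simulates_step(1)[OF wf w config_at_wf(1)[OF wf translate_Y[OF w]]])
qed

text \<open>After the given machine has halted, at most \<open>length w + 2\<close> further steps lead to the halting state,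
  since the head moves right in each of them.\<close>
lemma composite_outputs:
  assumes wf: "wf_transducer Y Z M" and w: "w \<in> lists X"
    and out: "outputs M (translate d u r w) v"
  shows "outputs (composite M z) w (v @ z (foldl d r w))"
proof -
  let ?C = "config_at M (translate d u r w)" and ?N = "config_at (composite M z) w"
  obtain t where t: "state (?C t) \<in> final M" "written (?C t) = v"
    using out unfolding outputs_def by blast
  have halted: "?C (t + m) = ?C t" for m
    by (induction m) (simp_all add: config_at_Suc step_final t(1))
  have progress: "state (?N (t + m)) = code M None \<or> m \<le> input_pos (?N (t + m))" for m
  proof (induction m)
    case (Suc m)
    have sim: "simulates M z w (?C (t + m)) (?N (t + m))"
      using simulates_config_at[OF wf w] .
    have "state (?C (t + m)) \<in> states M"
      using config_at_wf(1)[OF wf translate_Y[OF w]] .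
    from simulates_step(2)[OF wf w this sim] Suc show ?case
      using t(1) step_final[of "?N (t + m)" "composite M z" w]
      by (auto simp: halted config_at_Suc composite_def)
  qed simp
  define t' where "t' = t + (length w + 2)"
  have sim: "simulates M z w (?C t') (?N t')"
    using simulates_config_at[OF wf w] .
  then have None: "state (?N t') = code M None"
    using progress[of "length w + 2"] by (auto simp: simulates_def t'_def)
  have "state (?C t') \<in> states M" using config_at_wf(1)[OF wf translate_Y[OF w]] .
  then have "state (?N t') \<noteq> code M (Some (state (?C t'), k))" if "k \<in> cursors" for k
    using that None code_eq_None_iff[OF wf, of "Some (state (?C t'), k)"]
    by (simp add: run_states_def)
  then have "written (?N t') = written (?C t') @ z (foldl d r w)"
    using sim points_to_in_cursors[OF w] unfolding simulates_def by blast
  moreover have "?C t' = ?C t" unfolding t'_def by (rule halted)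
  moreover have "state (?N t') \<in> final (composite M z)"
    using None by (simp add: composite_def)
  ultimately show ?thesis
    using t(2) unfolding outputs_def by auto
qed

text \<open>Both machines have their work heads in the same place. The translated word is longer by a
  constant factor at most, which adds a constant to the logarithm; as
  \<open>log 2 (length w + 2) \<ge> 1\<close>, this is absorbed into the constant of the bound.\<close>
lemma composite_logspace_bounded:
  assumes wf: "wf_transducer Y Z M" and bd: "logspace_bounded Y M"
  shows "logspace_bounded X (composite M z)"
proof -
  obtain c where c: "\<And>w t. w \<in> lists Y \<Longrightarrow>
      real (work_pos (config_at M w t) + 1) \<le> c * log 2 (real (length w + 2))"
    using bd unfolding logspace_bounded_def by blast
  \<comment> \<open>the bound on the empty word shows that \<open>c\<close> is positive\<close>
  have "real (0 + 1) \<le> real (work_pos (config_at M [] 0) + 1)" by simp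
  also have "\<dots> \<le> c" using c[of "[]" 0] by simp
  finally have c0: "0 \<le> c" by simp
  let ?K = "real max_block"
  have K: "1 \<le> ?K" using max_block_ge_1 by simp
  have "real (work_pos (config_at (composite M z) w t) + 1)
      \<le> (c * (log 2 ?K + 1)) * log 2 (real (length w + 2))"
    if w: "w \<in> lists X" for w t
  proof -
    let ?l = "log 2 (real (length w + 2))"
    have l: "1 \<le> ?l" by simp
    have "length (translate d u r w) \<le> max_block * length w"
      using length_translate_le[of Q X d u, OF d_in_Q length_u_le start_in_Q w] .
    then have "length (translate d u r w) + 2 \<le> max_block * length w + 2 * max_block"
      using max_block_ge_1 by (intro add_mono) auto
    then have "length (translate d u r w) + 2 \<le> max_block * (length w + 2)"
      by (simp add: algebra_simps)
    then have "real (length (translate d u r w) + 2) \<le> ?K * real (length w + 2)"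
      by (metis of_nat_le_iff of_nat_mult)
    then have "log 2 (real (length (translate d u r w) + 2)) \<le> log 2 (?K * real (length w + 2))"
      by (subst log_le_cancel_iff) auto
    also have "\<dots> = log 2 ?K + ?l"
      using K by (simp add: log_mult)
    also have "\<dots> \<le> log 2 ?K * ?l + ?l"
      using l K mult_left_mono[OF l, of "log 2 ?K"] by simp
    finally have "log 2 (real (length (translate d u r w) + 2)) \<le> (log 2 ?K + 1) * ?l"
      by (simp add: algebra_simps)
    then have "c * log 2 (real (length (translate d u r w) + 2)) \<le> c * ((log 2 ?K + 1) * ?l)"
      using c0 by (rule mult_left_mono)
    moreover have "work_pos (config_at (composite M z) w t) =
        work_pos (config_at M (translate d u r w) t)"
      using simulates_config_at[OF wf w] by (simp add: simulates_def)
    ultimately show ?thesis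
      using c[OF translate_Y[OF w], of t] by (simp add: mult.assoc)
  qed
  then show ?thesis unfolding logspace_bounded_def by blast
qed

text \<open>The appended word \<open>z s\<close>, which depends on the last state \<open>s\<close>, is what will supply the coset
  representative at the end of a normal form.\<close>
lemma logspace_computable_translate_input:
  assumes f: "logspace_computable Y Z f" and z: "\<And>s. s \<in> Q \<Longrightarrow> z s \<in> lists Z'"
    and "Z \<subseteq> Z'" "finite Z'"
  shows "logspace_computable X Z' (\<lambda>w. f (translate d u r w) @ z (foldl d r w))"
proof -
  obtain M where wf: "wf_transducer Y Z M" and bd: "logspace_bounded Y M"
    and out: "\<And>w. w \<in> lists Y \<Longrightarrow> outputs M w (f w)"
    using f unfolding logspace_computable_def by blast
  have "wf_transducer X Z' (composite M z)"
    by (rule wf_composite[OF wf _ assms(3,4)]) (rule z)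
  moreover have "outputs (composite M z) w (f (translate d u r w) @ z (foldl d r w))"
    if "w \<in> lists X" for w
    using composite_outputs[OF wf that out[OF translate_Y[OF that]]] .
  ultimately show ?thesis
    using composite_logspace_bounded[OF wf bd] unfolding logspace_computable_def by blast
qed

end


section \<open>Words and normal forms in groups\<close>

lemma word_value_Nil [simp]: "word_value G [] = \<one>\<^bsub>G\<^esub>"
  by (simp add: word_value_def)

lemma word_value_Cons [simp]: "word_value G (x # w) = x \<otimes>\<^bsub>G\<^esub> word_value G w"
  by (simp add: word_value_def)

lemma word_value_subgroup [simp]: "word_value (G\<lparr>carrier := K\<rparr>) w = word_value G w"
  by (simp add: word_value_def)

lemma (in monoid) word_value_closed [simp]: "w \<in> lists (carrier G) \<Longrightarrow> word_value G w \<in> carrier G"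
  by (induction w) auto

lemma (in monoid) word_value_append:
  "v \<in> lists (carrier G) \<Longrightarrow> w \<in> lists (carrier G) \<Longrightarrow>
    word_value G (v @ w) = word_value G v \<otimes> word_value G w"
  by (induction v) (auto simp: m_assoc)

lemma (in group) word_value_in_subgroup:
  "subgroup K G \<Longrightarrow> w \<in> lists K \<Longrightarrow> word_value G w \<in> K"
  by (induction w) (auto intro: subgroup.one_closed subgroup.m_closed)

lemma (in group) word_value_substitution:
  assumes "\<And>x. x \<in> X \<Longrightarrow> p x \<in> lists (carrier G)" "\<And>x. x \<in> X \<Longrightarrow> word_value G (p x) = x"
    and "w \<in> lists X"
  shows "word_value G (translate (\<lambda>_ _. s) (\<lambda>_. p) s w) = word_value G w"
  using assms(3)
proof (induction w)
  case (Cons x w)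
  have "translate (\<lambda>_ _. s) (\<lambda>_. p) s w \<in> lists (carrier G)"
    using translate_in_lists[of "{s}" X "\<lambda>_ _. s" "\<lambda>_. p" "carrier G" s w] assms(1) Cons by blast
  then show ?case
    using Cons assms(1,2) by (simp add: word_value_append)
qed simp

lemma (in group) obtain_word:
  assumes "finite_symmetric_generating_set G X" "g \<in> carrier G"
  obtains w where "w \<in> lists X" "word_value G w = g"
proof -
  have X: "X \<subseteq> carrier G" using assms by (simp add: finite_symmetric_generating_set_def)
  have "g \<in> generate G X"
    using assms by (simp add: finite_symmetric_generating_set_def)
  then have "\<exists>w \<in> lists X. word_value G w = g"
  proof induction
    case one
    show ?case by (rule bexI[of _ "[]"]) auto
  next
    case (incl h)
    then show ?case using X by (intro bexI[of _ "[h]"]) auto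
  next
    case (inv h)
    then show ?case using X assms
      by (intro bexI[of _ "[inv h]"]) (auto simp: finite_symmetric_generating_set_def)
  next
    case (eng h1 h2)
    then obtain v w where "v \<in> lists X" "w \<in> lists X" "word_value G v = h1" "word_value G w = h2"
      by blast
    moreover from this have "word_value G (v @ w) = h1 \<otimes> h2"
      using word_value_append lists_mono[OF X] by blast
    ultimately show ?case by (intro bexI[of _ "v @ w"]) auto
  qed
  then show ?thesis using that by blast
qed

lemma (in group) obtain_nonempty_word:
  assumes "finite_symmetric_generating_set G X" "X \<noteq> {}" "g \<in> carrier G"
  obtains w where "w \<in> lists X" "w \<noteq> []" "word_value G w = g"
proof -
  obtain w where w: "w \<in> lists X" "word_value G w = g"
    using obtain_word[OF assms(1,3)] .
  show ?thesis
  proof (cases "w = []")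
    case True
    obtain x where "x \<in> X" using assms(2) by blast
    then show ?thesis
      using assms(1) True w
      by (intro that[of "[x, inv x]"]) (auto simp: finite_symmetric_generating_set_def)
  qed (use w that in blast)
qed

lemma (in group) finite_symmetric_generating_setI:
  assumes "finite X" "X \<subseteq> carrier G" "\<And>x. x \<in> X \<Longrightarrow> inv x \<in> X"
    and "\<And>g. g \<in> carrier G \<Longrightarrow> \<exists>w \<in> lists X. word_value G w = g"
  shows "finite_symmetric_generating_set G X"
proof -
  have "word_value G w \<in> generate G X" if "w \<in> lists X" for w
    using that by (intro word_value_in_subgroup generate_is_subgroup assms(2))
      (auto intro: generate.incl)
  then have "carrier G \<subseteq> generate G X" using assms(4) by blast
  then show ?thesis
    using assms(1-3) generate_incl[OF assms(2)]
    by (auto simp: finite_symmetric_generating_set_def)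
qed

lemma (in group) finite_symmetric_generating_set_subgroup:
  assumes "subgroup K G"
  shows "finite_symmetric_generating_set (G\<lparr>carrier := K\<rparr>) Y \<longleftrightarrow>
    finite Y \<and> Y \<subseteq> K \<and> (\<forall>y \<in> Y. inv y \<in> Y) \<and> generate G Y = K"
proof -
  have "inv\<^bsub>G\<lparr>carrier := K\<rparr>\<^esub> y = inv y" if "y \<in> K" for y
    using m_inv_consistent[OF assms that] .
  then show ?thesis
    using generate_consistent[OF _ assms]
    by (auto simp: finite_symmetric_generating_set_def subset_iff)
qed

lemma logspace_computable_in_lists:
  assumes "logspace_computable X Y f" "w \<in> lists X" shows "f w \<in> lists Y"
proof -
  obtain M where M: "wf_transducer X Y M" "outputs M w (f w)"
    using assms unfolding logspace_computable_def by blast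
  then obtain t where "written (config_at M w t) = f w"
    unfolding outputs_def by blast
  then show ?thesis using config_at_wf(3)[OF M(1) assms(2), of t] by simp
qed

text \<open>A normal form function without its normal form: the language can be taken to be the set of
  values of \<open>f\<close>, as \<open>logspace_normal_form_function_iff\<close> shows.\<close>
definition logspace_canonical :: "('a, 'b) monoid_scheme \<Rightarrow> 'a set \<Rightarrow> ('a list \<Rightarrow> 'a list) \<Rightarrow> bool" where
  "logspace_canonical G X f \<longleftrightarrow> logspace_computable X X f \<and>
     (\<forall>w \<in> lists X. word_value G (f w) = word_value G w) \<and>
     (\<forall>v \<in> lists X. \<forall>w \<in> lists X. word_value G v = word_value G w \<longrightarrow> f v = f w)"

lemma logspace_canonicalI:
  assumes "logspace_computable X X f"
    and "\<And>w. w \<in> lists X \<Longrightarrow> word_value G (f w) = word_value G w"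
    and "\<And>v w. v \<in> lists X \<Longrightarrow> w \<in> lists X \<Longrightarrow> word_value G v = word_value G w \<Longrightarrow> f v = f w"
  shows "logspace_canonical G X f"
  unfolding logspace_canonical_def by (intro conjI ballI impI assms)

lemma logspace_canonicalD:
  assumes "logspace_canonical G X f" "w \<in> lists X"
  shows "f w \<in> lists X" "word_value G (f w) = word_value G w"
    and "v \<in> lists X \<Longrightarrow> word_value G w = word_value G v \<Longrightarrow> f w = f v"
proof -
  have f: "logspace_computable X X f" "\<forall>w \<in> lists X. word_value G (f w) = word_value G w"
    "\<forall>v \<in> lists X. \<forall>w \<in> lists X. word_value G v = word_value G w \<longrightarrow> f v = f w"
    using assms(1) unfolding logspace_canonical_def by blast+
  show "f w \<in> lists X" using logspace_computable_in_lists[OF f(1) assms(2)] .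
  show "word_value G (f w) = word_value G w" using f(2) assms(2) by (rule bspec)
  show "v \<in> lists X \<Longrightarrow> word_value G w = word_value G v \<Longrightarrow> f w = f v"
    using f(3) assms(2) by blast
qed

lemma (in group) logspace_normal_form_function_iff:
  assumes X: "finite_symmetric_generating_set G X"
  shows "logspace_normal_form_function G X f \<longleftrightarrow> logspace_canonical G X f"
proof
  assume "logspace_normal_form_function G X f"
  then obtain L where "normal_form G X L" and f: "logspace_computable X X f"
    "\<And>w. w \<in> lists X \<Longrightarrow> f w \<in> L \<and> word_value G (f w) = word_value G w"
    unfolding logspace_normal_form_function_def by blast
  then have inj: "inj_on (word_value G) L"
    by (simp add: normal_form_def bij_betw_def)
  have "f v = f w" if "v \<in> lists X" "w \<in> lists X" "word_value G v = word_value G w" for v w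
    by (rule inj_onD[OF inj]) (use f(2)[OF that(1)] f(2)[OF that(2)] that(3) in simp_all)
  then show "logspace_canonical G X f"
    unfolding logspace_canonical_def using f by blast
next
  assume can: "logspace_canonical G X f"
  then have f: "\<And>w. w \<in> lists X \<Longrightarrow> f w \<in> lists X"
      "\<And>w. w \<in> lists X \<Longrightarrow> word_value G (f w) = word_value G w"
    unfolding logspace_canonical_def using logspace_computable_in_lists by blast+
  have "lists X \<subseteq> lists (carrier G)"
    using X by (intro lists_mono) (simp add: finite_symmetric_generating_set_def)
  then have "word_value G (f w) \<in> carrier G" if "w \<in> lists X" for w
    using f(1)[OF that] word_value_closed by blast
  moreover have "g \<in> word_value G ` f ` lists X" if g: "g \<in> carrier G" for g
  proof -
    obtain w where w: "w \<in> lists X" "word_value G w = g" by (rule obtain_word[OF X g])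
    then have "g = word_value G (f w)" using f(2) by simp
    then show ?thesis using w(1) by blast
  qed
  ultimately have "word_value G ` f ` lists X = carrier G" by blast
  moreover have "inj_on (word_value G) (f ` lists X)"
  proof (rule inj_onI)
    fix a b assume "a \<in> f ` lists X" "b \<in> f ` lists X" and eq: "word_value G a = word_value G b"
    then obtain v w where vw: "v \<in> lists X" "w \<in> lists X" and ab: "a = f v" "b = f w" by blast
    have "word_value G v = word_value G w"
      using eq f(2)[OF vw(1)] f(2)[OF vw(2)] by (simp only: ab)
    then show "a = b" using can vw unfolding ab logspace_canonical_def by blast
  qed
  ultimately have "normal_form G X (f ` lists X)"
    using f(1) unfolding normal_form_def bij_betw_def by blast
  then show "logspace_normal_form_function G X f"
    using can f(2) unfolding logspace_normal_form_function_def logspace_canonical_def by blast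
qed

lemma (in group) has_logspace_normal_formI:
  "finite_symmetric_generating_set G X \<Longrightarrow> logspace_canonical G X f \<Longrightarrow> has_logspace_normal_form G"
  using logspace_normal_form_function_iff
  unfolding has_logspace_normal_form_def has_logspace_normal_form_wrt_def by blast

text \<open>The generating set may be assumed nonempty: if it is empty, the group is trivial, and the
  constant function with value \<open>[]\<close> is a normal form function over the generating set \<open>{\<one>}\<close>.\<close>
lemma (in group) has_logspace_normal_formE:
  assumes "has_logspace_normal_form G"
  obtains X f where "finite_symmetric_generating_set G X" "X \<noteq> {}" "logspace_canonical G X f"
proof -
  obtain X f where X: "finite_symmetric_generating_set G X" and f: "logspace_canonical G X f"
    using assms logspace_normal_form_function_iff
    unfolding has_logspace_normal_form_def has_logspace_normal_form_wrt_def by blast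
  show ?thesis
  proof (cases "X = {}")
    case True
    then have "carrier G = {\<one>}"
      using X generate_empty by (simp add: finite_symmetric_generating_set_def)
    then have "finite_symmetric_generating_set G {\<one>}"
    proof (intro finite_symmetric_generating_setI)
      show "\<exists>w \<in> lists {\<one>}. word_value G w = g" if "g \<in> carrier G" for g
        using that \<open>carrier G = {\<one>}\<close> by (intro bexI[of _ "[]"]) auto
    qed auto
    moreover have "word_value G w = \<one>" if "w \<in> lists {\<one>}" for w
      using that by (induction w) auto
    then have "logspace_canonical G {\<one>} (\<lambda>_. [])"
      using logspace_computable_Nil[of "{\<one>}" "{\<one>}"] by (auto simp: logspace_canonical_def)
    ultimately show ?thesis using that by blast
  qed (use X f that in blast)
qed


section \<open>Schreier rewriting\<close>

text \<open>As the subgroup is represented by \<open>\<one>\<close>, the rewriting of a word that starts in it needs no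
  correction at the beginning, nor at the end if the value of the word lies in the subgroup.\<close>
locale coset_representatives = group G + subgroup K G for K and G (structure) +
  fixes rep :: "'a set \<Rightarrow> 'a"
  assumes rep_in_coset: "c \<in> rcosets K \<Longrightarrow> rep c \<in> c"
    and rep_subgroup: "rep K = \<one>"
begin

lemma sub: "subgroup K G" ..

lemma rcosets_mult_closed: "c \<in> rcosets K \<Longrightarrow> x \<in> carrier G \<Longrightarrow> c #> x \<in> rcosets K"
  by (auto simp: RCOSETS_def coset_mult_assoc subset)

lemma K_in_rcosets: "K \<in> rcosets K"
  using rcosetsI[OF subset, of \<one>] by (simp add: subset)

lemma rcosets_subset: "c \<in> rcosets K \<Longrightarrow> c \<subseteq> carrier G"
  using rcosets_part_G[OF sub] by blast

lemma rep_closed: "c \<in> rcosets K \<Longrightarrow> rep c \<in> carrier G"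
  using rep_in_coset rcosets_subset by blast

lemma coset_rep: "c \<in> rcosets K \<Longrightarrow> K #> rep c = c"
  using rep_in_coset repr_independence[OF _ _ sub] by (auto simp: RCOSETS_def)

lemma bij_betw_rcosets:
  assumes x: "x \<in> carrier G" shows "bij_betw (\<lambda>c. c #> x) (rcosets K) (rcosets K)"
  by (rule bij_betw_byWitness[of _ "\<lambda>c. c #> inv x"])
    (use x in \<open>auto simp: coset_mult_assoc rcosets_subset rcosets_mult_closed\<close>)

lemma foldl_coset:
  "c \<subseteq> carrier G \<Longrightarrow> w \<in> lists (carrier G) \<Longrightarrow> foldl (#>) c w = c #> word_value G w"
  by (induction w arbitrary: c) (auto simp: coset_mult_assoc r_coset_subset_G)

text \<open>The factor by which \<open>rep c \<otimes> x\<close> differs from the representative of its coset.\<close>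
definition schreier :: "'a set \<Rightarrow> 'a \<Rightarrow> 'a" where
  "schreier c x = rep c \<otimes> x \<otimes> inv (rep (c #> x))"

lemma schreier_in_subgroup:
  assumes "c \<in> rcosets K" "x \<in> carrier G" shows "schreier c x \<in> K"
proof -
  have cx: "c #> x \<in> rcosets K" using rcosets_mult_closed assms .
  have "K #> (rep c \<otimes> x) = K #> rep (c #> x)"
    using assms cx by (simp add: coset_mult_assoc[symmetric] subset rep_closed coset_rep)
  then have "K #> schreier c x = K"
    unfolding schreier_def by (intro coset_mult_inv2) (use assms cx in \<open>auto simp: subset rep_closed\<close>)
  then show ?thesis
    using coset_join1[OF _ _ sub] assms cx by (simp add: schreier_def rep_closed)
qed

text \<open>Inverting a Schreier element means travelling along the same edge of the coset graph in the
  opposite direction. Hence the Schreier generators of a symmetric set form a symmetric set.\<close>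
lemma inv_schreier:
  assumes "c \<in> rcosets K" "x \<in> carrier G"
  shows "inv (schreier c x) = schreier (c #> x) (inv x)"
proof -
  have "c #> x #> inv x = c" using assms by (simp add: coset_mult_assoc rcosets_subset)
  then show ?thesis
    using assms rcosets_mult_closed[OF assms]
    by (simp add: schreier_def inv_mult_group rep_closed m_assoc)
qed

text \<open>The telescoping product: the representative that ends one Schreier element cancels against the
  one that starts the next.\<close>
lemma schreier_rewriting:
  assumes u: "\<And>c x. c \<in> rcosets K \<Longrightarrow> x \<in> X \<Longrightarrow> u c x \<in> lists (carrier G)"
      "\<And>c x. c \<in> rcosets K \<Longrightarrow> x \<in> X \<Longrightarrow> word_value G (u c x) = schreier c x"
    and X: "X \<subseteq> carrier G" and "c \<in> rcosets K" "w \<in> lists X"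
  shows "rep c \<otimes> word_value G w =
    word_value G (translate (#>) u c w) \<otimes> rep (c #> word_value G w)"
  using assms(5,4)
proof (induction w arbitrary: c)
  case Nil
  then show ?case by (simp add: rcosets_subset rep_closed)
next
  case (Cons x w)
  have x: "x \<in> carrier G" using Cons X by auto
  have "w \<in> lists (carrier G)" using Cons(2) lists_mono[OF X] by blast
  then have w: "word_value G w \<in> carrier G" "w \<in> lists (carrier G)" by simp_all
  have cx: "c #> x \<in> rcosets K" using Cons x rcosets_mult_closed by simp
  have t: "translate (#>) u (c #> x) w \<in> lists (carrier G)"
    using translate_in_lists[of "rcosets K" X "(#>)" u, OF _ u(1) cx] Cons(1) X rcosets_mult_closed
    by (meson Cons.hyps(2) subsetD)
  have e: "c #> (x \<otimes> word_value G w) = c #> x #> word_value G w"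
    using Cons x w by (simp add: coset_mult_assoc rcosets_subset)
  have "schreier c x \<in> K" using schreier_in_subgroup[OF \<open>c \<in> rcosets K\<close> x] .
  then have sc: "schreier c x \<in> carrier G" using subset by blast
  have r: "rep c \<in> carrier G" "rep (c #> x) \<in> carrier G" "rep (c #> x #> word_value G w) \<in> carrier G"
    using rep_closed \<open>c \<in> rcosets K\<close> cx rcosets_mult_closed[OF cx w(1)] by blast+
  have "schreier c x \<otimes> rep (c #> x) = rep c \<otimes> x"
    using r x by (simp add: schreier_def m_assoc)
  then have "rep c \<otimes> (x \<otimes> word_value G w) = schreier c x \<otimes> (rep (c #> x) \<otimes> word_value G w)"
    using m_assoc[OF r(1) x w(1)] m_assoc[OF sc r(2) w(1)] by simp
  also have "\<dots> = schreier c x \<otimes> (word_value G (translate (#>) u (c #> x) w) \<otimes>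
      rep (c #> x #> word_value G w))"
    using Cons.IH[OF cx] by simp
  also have "\<dots> = schreier c x \<otimes> word_value G (translate (#>) u (c #> x) w) \<otimes>
      rep (c #> x #> word_value G w)"
    using m_assoc[OF sc word_value_closed[OF t] r(3)] by simp
  also have "schreier c x \<otimes> word_value G (translate (#>) u (c #> x) w) =
      word_value G (translate (#>) u c (x # w))"
    using word_value_append[OF u(1) t] u(2) Cons by simp
  finally show ?case by (simp add: e)
qed

end

lemma (in group) obtain_coset_representatives:
  assumes "subgroup K G" obtains rep where "coset_representatives K G rep"
proof -
  define rep where "rep c = (if c = K then \<one> else SOME x. x \<in> c)" for c
  have "rep c \<in> c" if "c \<in> rcosets K" for c
  proof -
    have "c \<noteq> {}" using that assms rcos_self by (auto simp: RCOSETS_def)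
    then show ?thesis
      using subgroup.one_closed[OF assms] by (auto simp: rep_def some_in_eq)
  qed
  then have "coset_representatives K G rep"
    by (intro coset_representatives.intro assms is_group coset_representatives_axioms.intro)
      (auto simp: rep_def)
  then show ?thesis using that by blast
qed


section \<open>Passing between a group and a subgroup of finite index\<close>

context coset_representatives
begin

definition schreier_generators :: "'a set \<Rightarrow> 'a set" where
  "schreier_generators X = (\<lambda>(c, x). schreier c x) ` ((rcosets K) \<times> X)"

abbreviation schreier_word :: "'a list \<Rightarrow> 'a list" where
  "schreier_word \<equiv> translate (#>) (\<lambda>c x. [schreier c x]) K"

lemma schreier_word_in_lists:
  assumes "X \<subseteq> carrier G" "w \<in> lists X"
  shows "schreier_word w \<in> lists (schreier_generators X)"
proof (rule translate_in_lists[OF _ _ K_in_rcosets assms(2)])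
  show "c #> x \<in> rcosets K" if "c \<in> rcosets K" "x \<in> X" for c x
    using rcosets_mult_closed[OF that(1) subsetD[OF assms(1) that(2)]] .
  show "[schreier c x] \<in> lists (schreier_generators X)" if "c \<in> rcosets K" "x \<in> X" for c x
    using that by (force simp: schreier_generators_def)
qed

lemma word_value_schreier_word:
  assumes X: "X \<subseteq> carrier G" and w: "w \<in> lists X" and K: "word_value G w \<in> K"
  shows "word_value G (schreier_word w) = word_value G w"
proof -
  let ?v = "schreier_word w"
  have c: "schreier c x \<in> carrier G" if "c \<in> rcosets K" "x \<in> X" for c x
    using subsetD[OF subset schreier_in_subgroup[OF that(1) subsetD[OF X that(2)]]] .
  have v: "?v \<in> lists (carrier G)"
  proof (rule translate_in_lists[OF _ _ K_in_rcosets w])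
    show "c #> x \<in> rcosets K" if "c \<in> rcosets K" "x \<in> X" for c x
      using rcosets_mult_closed[OF that(1) subsetD[OF X that(2)]] .
  qed (simp add: c)
  have "rep K \<otimes> word_value G w = word_value G ?v \<otimes> rep (K #> word_value G w)"
    by (rule schreier_rewriting[OF _ _ X K_in_rcosets w]) (use c in auto)
  moreover have "K #> word_value G w = K"
    using coset_join2[OF _ sub K] K subset by blast
  moreover have "word_value G w \<in> carrier G" using K subset by blast
  ultimately show ?thesis using v by (simp add: rep_subgroup)
qed

text \<open>Schreier's lemma: an element of the subgroup is spelled by a word over \<open>X\<close> whose walk through
  the cosets ends where it started, so rewriting leaves no representative over.\<close>
lemma schreier_generators_generate:
  assumes fin: "finite (rcosets K)" and X: "finite_symmetric_generating_set G X"
  shows "finite_symmetric_generating_set (G\<lparr>carrier := K\<rparr>) (schreier_generators X)"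
proof -
  have Xc: "X \<subseteq> carrier G" and Xinv: "\<And>x. x \<in> X \<Longrightarrow> inv x \<in> X" and "finite X"
    using X by (auto simp: finite_symmetric_generating_set_def)
  interpret K: group "G\<lparr>carrier := K\<rparr>" using subgroup_imp_group[OF sub] .
  show ?thesis
  proof (rule K.finite_symmetric_generating_setI)
    show "finite (schreier_generators X)"
      using fin \<open>finite X\<close> by (simp add: schreier_generators_def)
    show sub': "schreier_generators X \<subseteq> carrier (G\<lparr>carrier := K\<rparr>)"
      using schreier_in_subgroup Xc by (auto simp: schreier_generators_def)
    show "inv\<^bsub>G\<lparr>carrier := K\<rparr>\<^esub> y \<in> schreier_generators X" if y: "y \<in> schreier_generators X" for y
    proof -
      obtain c x where cx: "c \<in> rcosets K" "x \<in> X" "y = schreier c x"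
        using y by (auto simp: schreier_generators_def)
      have "inv\<^bsub>G\<lparr>carrier := K\<rparr>\<^esub> y = inv y"
        using m_inv_consistent[OF sub] sub' y by auto
      also have "\<dots> = schreier (c #> x) (inv x)"
        using inv_schreier cx Xc by auto
      also have "\<dots> \<in> schreier_generators X"
        using rcosets_mult_closed[OF cx(1)] cx(2) Xinv Xc unfolding schreier_generators_def
        by (intro image_eqI[of _ _ "(c #> x, inv x)"]) auto
      finally show ?thesis .
    qed
    show "\<exists>v \<in> lists (schreier_generators X). word_value (G\<lparr>carrier := K\<rparr>) v = g"
      if g: "g \<in> carrier (G\<lparr>carrier := K\<rparr>)" for g
    proof -
      have "g \<in> carrier G" using g subset by auto
      then obtain w where w: "w \<in> lists X" "word_value G w = g"
        by (rule obtain_word[OF X])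
      then have "word_value G (schreier_word w) = g"
        using word_value_schreier_word[OF Xc w(1)] g by simp
      then show ?thesis
        using schreier_word_in_lists[OF Xc w(1)] by auto
    qed
  qed
qed

text \<open>The normal form of a word over the Schreier generators is obtained by spelling it over the
  generators of the group, taking the normal form there, and rewriting that. The spelling is a
  reversible translation with a single state; the rewriting is done on the output, where a
  sequential translation suffices.\<close>
lemma has_logspace_normal_form_subgroup:
  assumes fin: "finite (rcosets K)" and nf: "has_logspace_normal_form G"
  shows "has_logspace_normal_form (G\<lparr>carrier := K\<rparr>)"
proof -
  obtain X f where X: "finite_symmetric_generating_set G X" "X \<noteq> {}" and f: "logspace_canonical G X f"
    using has_logspace_normal_formE[OF nf] .
  have Xc: "X \<subseteq> carrier G" and "finite X"
    using X by (auto simp: finite_symmetric_generating_set_def)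
  define Y where "Y = schreier_generators X"
  have Y: "finite_symmetric_generating_set (G\<lparr>carrier := K\<rparr>) Y"
    unfolding Y_def using schreier_generators_generate[OF fin X(1)] .
  then have "Y \<subseteq> K" "finite Y"
    by (auto simp: finite_symmetric_generating_set_subgroup[OF sub])
  interpret K: group "G\<lparr>carrier := K\<rparr>" using subgroup_imp_group[OF sub] .
  have "\<exists>v. v \<in> lists X \<and> v \<noteq> [] \<and> word_value G v = y" if "y \<in> Y" for y
    using obtain_nonempty_word[OF X, of y] that \<open>Y \<subseteq> K\<close> subset by blast
  then obtain p where p: "\<And>y. y \<in> Y \<Longrightarrow> p y \<in> lists X" "\<And>y. y \<in> Y \<Longrightarrow> p y \<noteq> []"
      "\<And>y. y \<in> Y \<Longrightarrow> word_value G (p y) = y"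
    by metis
  let ?sub = "translate (\<lambda>_ _. ()) (\<lambda>_. p) ()"
  interpret S: reversible_translation Y X "{()}" "()" "\<lambda>_ _. ()" "\<lambda>_. p"
    using p \<open>finite Y\<close> by unfold_locales (auto simp: bij_betw_def inj_on_def)
  have "logspace_computable X X f" using f by (simp add: logspace_canonical_def)
  then have "logspace_computable Y X (\<lambda>w. f (?sub w) @ [])"
    using S.logspace_computable_translate_input[of X f "\<lambda>_. []" X] \<open>finite X\<close> by simp
  then have comp: "logspace_computable Y Y (\<lambda>w. schreier_word (f (?sub w) @ []))"
  proof (rule logspace_computable_translate_output[OF _ \<open>finite Y\<close> fin K_in_rcosets])
    show "c #> x \<in> rcosets K" if "c \<in> rcosets K" "x \<in> X" for c x
      using rcosets_mult_closed[OF that(1) subsetD[OF Xc that(2)]] .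
    show "[schreier c x] \<in> lists Y" if "c \<in> rcosets K" "x \<in> X" for c x
      using that by (force simp: Y_def schreier_generators_def)
  qed
  have val: "word_value G (?sub w) = word_value G w" if "w \<in> lists Y" for w
    using word_value_substitution[of Y p w "()"] p(1,3) lists_mono[OF Xc] that by blast
  have value_f: "word_value G (schreier_word (f (?sub w))) = word_value G w" if w: "w \<in> lists Y" for w
  proof -
    have s: "?sub w \<in> lists X" using S.translate_Y[OF w] .
    have fs: "f (?sub w) \<in> lists X" "word_value G (f (?sub w)) = word_value G w"
      using logspace_canonicalD(1,2)[OF f s] val[OF w] by simp_all
    moreover have "word_value G w \<in> K"
      using word_value_in_subgroup[OF sub] lists_mono[OF \<open>Y \<subseteq> K\<close>] w by blast
    ultimately show ?thesis using word_value_schreier_word[OF Xc fs(1)] by simp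
  qed
  have det: "schreier_word (f (?sub v)) = schreier_word (f (?sub w))"
    if vw: "v \<in> lists Y" "w \<in> lists Y" "word_value G v = word_value G w" for v w
    by (rule arg_cong[where f = schreier_word],
        rule logspace_canonicalD(3)[OF f S.translate_Y[OF vw(1)] S.translate_Y[OF vw(2)]])
      (simp only: val[OF vw(1)] val[OF vw(2)] vw(3))
  have "logspace_canonical (G\<lparr>carrier := K\<rparr>) Y (\<lambda>w. schreier_word (f (?sub w)))"
  proof (rule logspace_canonicalI)
    show "logspace_computable Y Y (\<lambda>w. schreier_word (f (?sub w)))"
      using comp by (simp only: append_Nil2)
    show "word_value (G\<lparr>carrier := K\<rparr>) (schreier_word (f (?sub w))) =
        word_value (G\<lparr>carrier := K\<rparr>) w" if "w \<in> lists Y" for w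
      unfolding word_value_subgroup using that by (rule value_f)
    show "schreier_word (f (?sub v)) = schreier_word (f (?sub w))"
      if "v \<in> lists Y" "w \<in> lists Y"
        "word_value (G\<lparr>carrier := K\<rparr>) v = word_value (G\<lparr>carrier := K\<rparr>) w" for v w
      using that(3) by (intro det that(1,2)) (simp only: word_value_subgroup)
  qed
  then show ?thesis by (rule K.has_logspace_normal_formI[OF Y])
qed

text \<open>Here the rewriting is applied to the input. The states are the cosets, which every generator
  permutes, so the translation is reversible. The normal form of an element is the normal form of
  its subgroup part followed by its coset representative.\<close>
lemma has_logspace_normal_form_overgroup:
  assumes fin: "finite (rcosets K)" and nf: "has_logspace_normal_form (G\<lparr>carrier := K\<rparr>)"
  shows "has_logspace_normal_form G"
proof -
  interpret K: group "G\<lparr>carrier := K\<rparr>" using subgroup_imp_group[OF sub] .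
  obtain Y f where Y: "finite_symmetric_generating_set (G\<lparr>carrier := K\<rparr>) Y" "Y \<noteq> {}"
    and f: "logspace_canonical (G\<lparr>carrier := K\<rparr>) Y f"
    using K.has_logspace_normal_formE[OF nf] .
  have YK: "Y \<subseteq> K" and "finite Y" and Yinv: "\<And>y. y \<in> Y \<Longrightarrow> inv y \<in> Y"
    using Y(1) by (auto simp: finite_symmetric_generating_set_subgroup[OF sub])
  define R where "R = rep ` (rcosets K)"
  define X where "X = Y \<union> R \<union> m_inv G ` R"
  have Rc: "R \<subseteq> carrier G" using rep_closed by (auto simp: R_def)
  have Xc: "X \<subseteq> carrier G" using Rc YK subset by (auto simp: X_def)
  have "finite X" using fin \<open>finite Y\<close> by (simp add: X_def R_def)
  have X: "finite_symmetric_generating_set G X"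
  proof (rule finite_symmetric_generating_setI[OF \<open>finite X\<close> Xc])
    show "inv x \<in> X" if "x \<in> X" for x
      using that Yinv Rc by (auto simp: X_def subset_iff)
    show "\<exists>w \<in> lists X. word_value G w = g" if g: "g \<in> carrier G" for g
    proof -
      have "K #> g \<in> rcosets K" using rcosetsI[OF subset g] .
      then have r: "rep (K #> g) \<in> K #> g" "rep (K #> g) \<in> R"
        using rep_in_coset by (auto simp: R_def)
      have rc: "rep (K #> g) \<in> carrier G" using r Rc by blast
      have "g \<in> K #> rep (K #> g)"
        using coset_rep[OF \<open>K #> g \<in> rcosets K\<close>] rcos_self[OF g sub] by simp
      then obtain h where h: "h \<in> K" "g = h \<otimes> rep (K #> g)"
        by (auto simp: r_coset_def)
      obtain v where v: "v \<in> lists Y" "word_value (G\<lparr>carrier := K\<rparr>) v = h"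
        by (rule K.obtain_word[OF Y(1), of h]) (use h in auto)
      have "Y \<subseteq> carrier G" using YK subset by blast
      then have "v \<in> lists (carrier G)" using v(1) lists_mono by blast
      then have "word_value G (v @ [rep (K #> g)]) = g"
        using v(2) h(2) rc by (simp add: word_value_append)
      moreover have "v @ [rep (K #> g)] \<in> lists X" using v(1) r(2) by (auto simp: X_def)
      ultimately show ?thesis by blast
    qed
  qed
  have "\<exists>v. v \<in> lists Y \<and> v \<noteq> [] \<and> word_value G v = schreier c x"
    if "c \<in> rcosets K" "x \<in> X" for c x
  proof -
    have "schreier c x \<in> carrier (G\<lparr>carrier := K\<rparr>)"
      using schreier_in_subgroup that Xc by auto
    from K.obtain_nonempty_word[OF Y this] show ?thesis by (metis word_value_subgroup)
  qed
  then obtain u where u: "\<And>c x. c \<in> rcosets K \<Longrightarrow> x \<in> X \<Longrightarrow> u c x \<in> lists Y"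
      "\<And>c x. c \<in> rcosets K \<Longrightarrow> x \<in> X \<Longrightarrow> u c x \<noteq> []"
      "\<And>c x. c \<in> rcosets K \<Longrightarrow> x \<in> X \<Longrightarrow> word_value G (u c x) = schreier c x"
    by metis
  interpret S: reversible_translation X Y "rcosets K" K "(#>)" u
    using u \<open>finite X\<close> fin K_in_rcosets bij_betw_rcosets Xc by unfold_locales auto
  let ?g = "translate (#>) u K"
  let ?F = "\<lambda>w. f (?g w) @ [rep (foldl (#>) K w)]"
  have "logspace_computable Y Y f" using f by (simp add: logspace_canonical_def)
  then have comp: "logspace_computable X X ?F"
    by (rule S.logspace_computable_translate_input[where z = "\<lambda>c. [rep c]"])
      (use \<open>finite X\<close> in \<open>auto simp: X_def R_def\<close>)
  have Y_lists: "lists Y \<subseteq> lists (carrier G)" using lists_mono YK subset by (meson order_trans)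
  have gval: "word_value G w = word_value G (?g w) \<otimes> rep (K #> word_value G w)"
    and end_coset: "foldl (#>) K w = K #> word_value G w"
    and rc: "rep (K #> word_value G w) \<in> carrier G"
    and gc: "word_value G (?g w) \<in> carrier G"
    if w: "w \<in> lists X" for w
  proof -
    have w': "w \<in> lists (carrier G)" using lists_mono[OF Xc] w by blast
    then show "foldl (#>) K w = K #> word_value G w"
      using foldl_coset[OF subset] by blast
    show "rep (K #> word_value G w) \<in> carrier G"
      using rep_closed[OF rcosetsI[OF subset word_value_closed[OF w']]] .
    show "word_value G (?g w) \<in> carrier G"
      using word_value_closed Y_lists S.translate_Y[OF w] by blast
    have "rep K \<otimes> word_value G w = word_value G (?g w) \<otimes> rep (K #> word_value G w)"
      by (rule schreier_rewriting[OF _ u(3) Xc K_in_rcosets w]) (use u(1) Y_lists in blast)+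
    then show "word_value G w = word_value G (?g w) \<otimes> rep (K #> word_value G w)"
      using word_value_closed[OF w'] by (simp add: rep_subgroup)
  qed
  have "word_value G (?F w) = word_value G w" if w: "w \<in> lists X" for w
  proof -
    have "f (?g w) \<in> lists Y" "word_value G (f (?g w)) = word_value G (?g w)"
      using logspace_canonicalD(1,2)[OF f S.translate_Y[OF w]] by simp_all
    moreover from this(1) have "f (?g w) \<in> lists (carrier G)" using Y_lists by blast
    ultimately show ?thesis
      using gval[OF w] rc[OF w] by (simp add: word_value_append end_coset[OF w])
  qed
  moreover have "?F v = ?F w"
    if vw: "v \<in> lists X" "w \<in> lists X" "word_value G v = word_value G w" for v w
  proof -
    let ?r = "rep (K #> word_value G w)"
    have "word_value G (?g v) \<otimes> ?r = word_value G v"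
      using gval[OF vw(1)] by (simp only: vw(3))
    also have "\<dots> = word_value G (?g w) \<otimes> ?r"
      using gval[OF vw(2)] by (simp only: vw(3))
    finally have "word_value G (?g v) = word_value G (?g w)"
      using right_cancel[OF rc[OF vw(2)] gc[OF vw(1)] gc[OF vw(2)]] by blast
    then have "f (?g v) = f (?g w)"
      by (intro logspace_canonicalD(3)[OF f S.translate_Y[OF vw(1)] S.translate_Y[OF vw(2)]]) simp
    then show ?thesis
      by (simp only: end_coset[OF vw(1)] end_coset[OF vw(2)] vw(3))
  qed
  ultimately have "logspace_canonical G X ?F"
    by (intro logspace_canonicalI[OF comp])
  then show ?thesis by (rule has_logspace_normal_formI[OF X])
qed

end

theorem proposition16:
  fixes H :: "('a, 'b) monoid_scheme" and G :: "'a set"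
  assumes "group H"
    and "subgroup G H"
    and "finite (rcosets\<^bsub>H\<^esub> G)"
    and "finitely_generated H"
    and "finitely_generated (H\<lparr>carrier := G\<rparr>)"
  shows "has_logspace_normal_form H \<longleftrightarrow> has_logspace_normal_form (H\<lparr>carrier := G\<rparr>)"
proof -
  obtain rep where "coset_representatives G H rep"
    using group.obtain_coset_representatives[OF assms(1,2)] .
  then interpret coset_representatives G H rep .
  show ?thesis
    using has_logspace_normal_form_subgroup[OF assms(3)]
      has_logspace_normal_form_overgroup[OF assms(3)] by blast
qed

end
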